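(* For all integers $m, n, k$ with $n > m \geqslant k \geqslant 3$ there exist non-isomorphic finite $2$-groups $G$ and $H$, each of order $2^{m+n+k-1}$ and each having cyclic commutator subgroup of order $2^{k-1}$, such that the group algebras $\mathbb{F}_2 G$ and $\mathbb{F}_2 H$ over the field $\mathbb{F}_2$ with two elements are isomorphic as $\mathbb{F}_2$-algebras. *)

theory Defs
  imports "HOL-Algebra.Algebra" "HOL-Number_Theory.Residues"
begin

definition finite_p_group :: "nat \<Rightarrow> ('g, 'x) monoid_scheme \<Rightarrow> bool" where
  "finite_p_group p G \<longleftrightarrow>
     Factorial_Ring.prime p \<and> group G \<and> finite (carrier G) \<and> (\<exists>e. order G = p ^ e)"

definition commutator_subgroup :: "('g, 'x) monoid_scheme \<Rightarrow> ('g, 'x) monoid_scheme" where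
  "commutator_subgroup G = G\<lparr>carrier := derived G (carrier G)\<rparr>"

(* A formal K-linear combination of elements of G is encoded as its coefficient function, which is
   extensional (equal to undefined outside the carrier of G) and has finite support. *)

definition group_algebra_supp ::
    "('k, 'r) ring_scheme \<Rightarrow> ('g, 'x) monoid_scheme \<Rightarrow> ('g \<Rightarrow> 'k) \<Rightarrow> 'g set" where
  "group_algebra_supp K G f = {g \<in> carrier G. f g \<noteq> \<zero>\<^bsub>K\<^esub>}"

(* The product is the convolution: the coefficient at g collects f x * h y over all x, y with
   x y = g, that is y = x^(-1) g. *)

definition group_algebra ::
    "('k, 'r) ring_scheme \<Rightarrow> ('g, 'x) monoid_scheme \<Rightarrow> ('k, 'g \<Rightarrow> 'k) module" where
  "group_algebra K G =
     \<lparr>carrier = {f \<in> carrier G \<rightarrow>\<^sub>E carrier K. finite (group_algebra_supp K G f)},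
      monoid.mult = (\<lambda>f h. \<lambda>g\<in>carrier G.
        \<Oplus>\<^bsub>K\<^esub>x\<in>group_algebra_supp K G f. f x \<otimes>\<^bsub>K\<^esub> h (inv\<^bsub>G\<^esub> x \<otimes>\<^bsub>G\<^esub> g)),
      monoid.one = (\<lambda>g\<in>carrier G. if g = \<one>\<^bsub>G\<^esub> then \<one>\<^bsub>K\<^esub> else \<zero>\<^bsub>K\<^esub>),
      ring.zero = (\<lambda>g\<in>carrier G. \<zero>\<^bsub>K\<^esub>),
      ring.add = (\<lambda>f h. \<lambda>g\<in>carrier G. f g \<oplus>\<^bsub>K\<^esub> h g),
      module.smult = (\<lambda>a f. \<lambda>g\<in>carrier G. a \<otimes>\<^bsub>K\<^esub> f g)\<rparr>"

(* The locale algebra of HOL-Algebra covers commutative algebras only, so isomorphisms of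
   unital associative algebras are defined here: K-linear ring isomorphisms. *)

definition algebra_iso ::
    "('k, 'r) ring_scheme \<Rightarrow> ('k, 'a, 'x) module_scheme \<Rightarrow> ('k, 'b, 'y) module_scheme
      \<Rightarrow> ('a \<Rightarrow> 'b) set" where
  "algebra_iso K A B =
     {\<phi> \<in> ring_iso A B. \<forall>a\<in>carrier K. \<forall>x\<in>carrier A. \<phi> (a \<odot>\<^bsub>A\<^esub> x) = a \<odot>\<^bsub>B\<^esub> \<phi> x}"

definition algebras_isomorphic ::
    "('k, 'r) ring_scheme \<Rightarrow> ('k, 'a, 'x) module_scheme \<Rightarrow> ('k, 'b, 'y) module_scheme \<Rightarrow> bool"
  where
  "algebras_isomorphic K A B \<longleftrightarrow> algebra_iso K A B \<noteq> {}"

end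

theory Submission
  imports Defs
begin

text \<open>
  On triples \<open>(i, j, r)\<close> modulo \<open>(2\<^sup>n, 2\<^sup>m, 2\<^sup>k)\<close> with \<open>j + r\<close> even, let \<open>(i, j, r)\<close> act on
  the last coordinate of the second factor of a product by the sign \<open>-1\<close> to the power \<open>i + e j\<close>;
  \<open>G\<close> is the group for \<open>e = 1\<close> and \<open>H\<close> the one for \<open>e = 0\<close>. Put \<open>q = 2\<^sup>l\<close> with \<open>l = k - 1\<close>,
  \<open>N = 2\<^sup>n\<close> and \<open>M = 2\<^sup>m\<close>. Both groups are generated by two elements \<open>x\<close>, \<open>y\<close> with central
  squares such that \<open>(xy)\<^sup>q = (yx)\<^sup>q\<close> and \<open>x\<^sup>N = 1\<close>; one further relation completes a presentation,
  namely \<open>y\<^sup>M = 1\<close> for \<open>G\<close> and \<open>y\<^sup>M = x\<^sup>M\<close> for \<open>H\<close>.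

  In the group algebra of \<open>H\<close> the element \<open>xy + yx\<close> is central, because conjugation by \<open>x\<close> or \<open>y\<close>
  swaps \<open>xy\<close> and \<open>yx\<close>. Hence \<open>Y = 1 + x + y\<close> again has a central square, namely
  \<open>1 + x\<^sup>2 + y\<^sup>2 + (xy + yx)\<close>. In characteristic 2 the \<open>q\<close>-th power of \<open>xy + yx = xY + Yx\<close> is
  \<open>(xy)\<^sup>q + (yx)\<^sup>q = 0\<close>, so \<open>(xY)\<^sup>q = (Yx)\<^sup>q\<close>, and as \<open>2 q\<close> divides \<open>M\<close> also
  \<open>Y\<^sup>M = 1 + x\<^sup>M + y\<^sup>M = 1\<close>. Thus \<open>x\<close> and \<open>Y\<close> satisfy the relations of \<open>G\<close>. The resulting algebra
  homomorphism is onto, as \<open>y = 1 + x + Y\<close>, and both algebras have the same finite cardinality.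

  The groups differ: \<open>H\<close> has an element \<open>g\<close> with \<open>g\<^sup>M = 1\<close> and a commutator \<open>c\<close> of \<open>g\<close> with another
  element such that \<open>c\<close> commutes with \<open>g\<close> and generates the commutator subgroup. In \<open>G\<close> such a \<open>g\<close>
  has odd coordinates \<open>i\<close> and \<open>j\<close>, which contradicts \<open>g\<^sup>M = 1\<close> since \<open>M < N\<close>.
\<close>

section \<open>Group algebras of finite groups\<close>

text \<open>Induction on \<open>A\<close>, splitting off one factor. The product form lets the
  additive monoid of a ring inherit the result as \<open>finsum_swap\<close>.\<close>

lemma (in comm_monoid) finprod_swap:
  assumes "finite A" "finite B" "\<And>x y. x \<in> A \<Longrightarrow> y \<in> B \<Longrightarrow> f x y \<in> carrier G"
  shows "(\<Otimes>x\<in>A. \<Otimes>y\<in>B. f x y) = (\<Otimes>y\<in>B. \<Otimes>x\<in>A. f x y)"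
  using assms(1,3)
proof (induction A rule: finite_induct)
  case empty
  then show ?case by simp
next
  case (insert a A)
  have "(\<Otimes>x\<in>insert a A. \<Otimes>y\<in>B. f x y) = (\<Otimes>y\<in>B. f a y) \<otimes> (\<Otimes>x\<in>A. \<Otimes>y\<in>B. f x y)"
    using insert by (intro finprod_insert) auto
  also have "\<dots> = (\<Otimes>y\<in>B. f a y) \<otimes> (\<Otimes>y\<in>B. \<Otimes>x\<in>A. f x y)"
    using insert by simp
  also have "\<dots> = (\<Otimes>y\<in>B. f a y \<otimes> (\<Otimes>x\<in>A. f x y))"
    using insert by (intro finprod_multf[symmetric]) auto
  also have "\<dots> = (\<Otimes>y\<in>B. \<Otimes>x\<in>insert a A. f x y)"
    using insert by (intro finprod_cong') (auto simp: finprod_insert)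
  finally show ?case .
qed

lemmas (in abelian_monoid) finsum_swap = add.finprod_swap

text \<open>The two axioms make the product bilinear over \<open>K\<close>; \<open>A\<close> may be
  noncommutative, as group algebras require.\<close>

locale associative_algebra = module K A + ring A for K (structure) and A (structure) +
  assumes smult_mult_left: "\<lbrakk>a \<in> carrier K; x \<in> carrier A; y \<in> carrier A\<rbrakk>
      \<Longrightarrow> (a \<odot>\<^bsub>A\<^esub> x) \<otimes>\<^bsub>A\<^esub> y = a \<odot>\<^bsub>A\<^esub> (x \<otimes>\<^bsub>A\<^esub> y)"
    and smult_mult_right: "\<lbrakk>a \<in> carrier K; x \<in> carrier A; y \<in> carrier A\<rbrakk>
      \<Longrightarrow> x \<otimes>\<^bsub>A\<^esub> (a \<odot>\<^bsub>A\<^esub> y) = a \<odot>\<^bsub>A\<^esub> (x \<otimes>\<^bsub>A\<^esub> y)"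

locale finite_group_algebra = K: cring K + G: group G
  for K :: "('k, 'r) ring_scheme" (structure) and G :: "('g, 'x) monoid_scheme" (structure) +
  assumes finite_G: "finite (carrier G)"
begin

abbreviation KG where "KG \<equiv> group_algebra K G"

lemma carrier_KG: "carrier KG = carrier G \<rightarrow>\<^sub>E carrier K"
  using finite_G by (auto simp: group_algebra_def group_algebra_supp_def)

lemma KG_closed [simp]: "f \<in> carrier KG \<Longrightarrow> g \<in> carrier G \<Longrightarrow> f g \<in> carrier K"
  by (auto simp: carrier_KG)

lemma KG_eqI:
  assumes "f \<in> carrier KG" "h \<in> carrier KG" "\<And>g. g \<in> carrier G \<Longrightarrow> f g = h g"
  shows "f = h"
  using assms unfolding carrier_KG by (rule PiE_ext)

text \<open>Terms outside the support vanish, so the sum may run over the whole group, an index set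
  that does not depend on \<open>f\<close>. Later calculations with products start from this
  form.\<close>

lemma mult_KG_apply:
  assumes "f \<in> carrier KG" "h \<in> carrier KG" "g \<in> carrier G"
  shows "(f \<otimes>\<^bsub>KG\<^esub> h) g = (\<Oplus>\<^bsub>K\<^esub>x\<in>carrier G. f x \<otimes>\<^bsub>K\<^esub> h (inv\<^bsub>G\<^esub> x \<otimes>\<^bsub>G\<^esub> g))"
proof -
  have "(\<Oplus>\<^bsub>K\<^esub>x\<in>group_algebra_supp K G f. f x \<otimes>\<^bsub>K\<^esub> h (inv\<^bsub>G\<^esub> x \<otimes>\<^bsub>G\<^esub> g))
      = (\<Oplus>\<^bsub>K\<^esub>x\<in>carrier G. f x \<otimes>\<^bsub>K\<^esub> h (inv\<^bsub>G\<^esub> x \<otimes>\<^bsub>G\<^esub> g))"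
    using finite_G assms
    by (intro K.add.finprod_mono_neutral_cong_left) (auto simp: group_algebra_supp_def)
  then show ?thesis
    using assms(3) by (simp add: group_algebra_def)
qed

lemma add_KG_apply: "g \<in> carrier G \<Longrightarrow> (f \<oplus>\<^bsub>KG\<^esub> h) g = f g \<oplus>\<^bsub>K\<^esub> h g"
  by (simp add: group_algebra_def)

lemma zero_KG_apply: "g \<in> carrier G \<Longrightarrow> \<zero>\<^bsub>KG\<^esub> g = \<zero>\<^bsub>K\<^esub>"
  by (simp add: group_algebra_def)

lemma smult_KG_apply: "g \<in> carrier G \<Longrightarrow> (a \<odot>\<^bsub>KG\<^esub> f) g = a \<otimes>\<^bsub>K\<^esub> f g"
  by (simp add: group_algebra_def)

definition basis :: "'g \<Rightarrow> 'g \<Rightarrow> 'k" where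
  "basis x = (\<lambda>g\<in>carrier G. if g = x then \<one>\<^bsub>K\<^esub> else \<zero>\<^bsub>K\<^esub>)"

lemma basis_apply: "g \<in> carrier G \<Longrightarrow> basis x g = (if g = x then \<one>\<^bsub>K\<^esub> else \<zero>\<^bsub>K\<^esub>)"
  by (simp add: basis_def)

lemma one_KG: "\<one>\<^bsub>KG\<^esub> = basis \<one>\<^bsub>G\<^esub>"
  by (simp add: group_algebra_def basis_def)

lemma basis_closed [simp]: "basis x \<in> carrier KG"
  by (auto simp: carrier_KG basis_def)

lemma mult_KG_closed:
  assumes "f \<in> carrier KG" "h \<in> carrier KG"
  shows "f \<otimes>\<^bsub>KG\<^esub> h \<in> carrier KG"
proof -
  have "(f \<otimes>\<^bsub>KG\<^esub> h) g \<in> carrier K" if "g \<in> carrier G" for g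
    unfolding mult_KG_apply[OF assms that] using assms that by (auto intro!: K.finsum_closed)
  moreover have "(f \<otimes>\<^bsub>KG\<^esub> h) \<in> extensional (carrier G)"
    by (simp add: group_algebra_def)
  ultimately show ?thesis
    by (simp add: carrier_KG PiE_def)
qed

lemma add_KG_closed:
  assumes "f \<in> carrier KG" "h \<in> carrier KG"
  shows "f \<oplus>\<^bsub>KG\<^esub> h \<in> carrier KG"
  using assms unfolding carrier_KG by (auto simp: group_algebra_def)

lemma zero_KG_closed: "\<zero>\<^bsub>KG\<^esub> \<in> carrier KG"
  unfolding carrier_KG by (auto simp: group_algebra_def)

lemma smult_KG_closed:
  assumes "a \<in> carrier K" "f \<in> carrier KG"
  shows "a \<odot>\<^bsub>KG\<^esub> f \<in> carrier KG"
  using assms unfolding carrier_KG by (auto simp: group_algebra_def)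

lemmas KG_closures = mult_KG_closed add_KG_closed zero_KG_closed smult_KG_closed

lemma finsum_delta:
  assumes "x \<in> carrier G" "\<And>y. y \<in> carrier G \<Longrightarrow> f y \<in> carrier K"
  shows "(\<Oplus>\<^bsub>K\<^esub>y\<in>carrier G. if y = x then f y else \<zero>\<^bsub>K\<^esub>) = f x"
  using K.finsum_singleton[of x "carrier G" f] assms finite_G by (auto simp: eq_commute)

lemma basis_mult_apply:
  assumes x: "x \<in> carrier G" and f: "f \<in> carrier KG" and g: "g \<in> carrier G"
  shows "(basis x \<otimes>\<^bsub>KG\<^esub> f) g = f (inv\<^bsub>G\<^esub> x \<otimes>\<^bsub>G\<^esub> g)"
proof -
  have "(basis x \<otimes>\<^bsub>KG\<^esub> f) g
      = (\<Oplus>\<^bsub>K\<^esub>y\<in>carrier G. if y = x then f (inv\<^bsub>G\<^esub> y \<otimes>\<^bsub>G\<^esub> g) else \<zero>\<^bsub>K\<^esub>)"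
    unfolding mult_KG_apply[OF basis_closed f g]
    using f g by (intro K.finsum_cong') (auto simp: basis_apply)
  also have "\<dots> = f (inv\<^bsub>G\<^esub> x \<otimes>\<^bsub>G\<^esub> g)"
    using x f g by (intro finsum_delta) auto
  finally show ?thesis .
qed

lemma basis_mult:
  assumes "x \<in> carrier G" "y \<in> carrier G"
  shows "basis x \<otimes>\<^bsub>KG\<^esub> basis y = basis (x \<otimes>\<^bsub>G\<^esub> y)"
proof (rule KG_eqI)
  fix g assume g: "g \<in> carrier G"
  have "inv\<^bsub>G\<^esub> x \<otimes>\<^bsub>G\<^esub> g = y \<longleftrightarrow> g = x \<otimes>\<^bsub>G\<^esub> y"
    using assms g by (metis G.inv_closed G.inv_solve_left)
  then show "(basis x \<otimes>\<^bsub>KG\<^esub> basis y) g = basis (x \<otimes>\<^bsub>G\<^esub> y) g"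
    using assms g by (simp add: basis_mult_apply basis_apply)
qed (auto intro: KG_closures)

lemma mult_KG_assoc:
  assumes fhk: "f \<in> carrier KG" "h \<in> carrier KG" "k \<in> carrier KG"
  shows "(f \<otimes>\<^bsub>KG\<^esub> h) \<otimes>\<^bsub>KG\<^esub> k = f \<otimes>\<^bsub>KG\<^esub> (h \<otimes>\<^bsub>KG\<^esub> k)"
proof (rule KG_eqI)
  fix g assume g: "g \<in> carrier G"
  let ?C = "carrier G"
  \<comment> \<open>Once \<open>f y\<close> is pulled out, \<open>w y x\<close> is what remains of
    the term of the double sum at \<open>x\<close> and \<open>y\<close>. Summing over
    \<open>x\<close> first then yields the other bracketing.\<close>
  define w where "w = (\<lambda>y x. h (inv\<^bsub>G\<^esub> y \<otimes>\<^bsub>G\<^esub> x) \<otimes>\<^bsub>K\<^esub> k (inv\<^bsub>G\<^esub> x \<otimes>\<^bsub>G\<^esub> g))"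
  have w_closed: "w y x \<in> carrier K" if "y \<in> ?C" "x \<in> ?C" for x y
    using that g fhk by (simp add: w_def)
  have sum_w: "(\<Oplus>\<^bsub>K\<^esub>x\<in>?C. w y x) = (h \<otimes>\<^bsub>KG\<^esub> k) (inv\<^bsub>G\<^esub> y \<otimes>\<^bsub>G\<^esub> g)" if y: "y \<in> ?C" for y
  proof -
    \<comment> \<open>Left translation by \<open>y\<close> permutes the group; this is the summand
      after the substitution of \<open>y u\<close> for \<open>x\<close>.\<close>
    have w_mult: "w y (y \<otimes>\<^bsub>G\<^esub> u) = h u \<otimes>\<^bsub>K\<^esub> k (inv\<^bsub>G\<^esub> u \<otimes>\<^bsub>G\<^esub> (inv\<^bsub>G\<^esub> y \<otimes>\<^bsub>G\<^esub> g))"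
      if u: "u \<in> ?C" for u
    proof -
      have "inv\<^bsub>G\<^esub> y \<otimes>\<^bsub>G\<^esub> (y \<otimes>\<^bsub>G\<^esub> u) = u"
        using y u by (simp add: G.m_assoc[symmetric])
      moreover have "inv\<^bsub>G\<^esub> (y \<otimes>\<^bsub>G\<^esub> u) \<otimes>\<^bsub>G\<^esub> g = inv\<^bsub>G\<^esub> u \<otimes>\<^bsub>G\<^esub> (inv\<^bsub>G\<^esub> y \<otimes>\<^bsub>G\<^esub> g)"
        using y u g by (simp add: G.inv_mult_group G.m_assoc)
      ultimately show ?thesis
        by (simp add: w_def)
    qed
    have "(\<Oplus>\<^bsub>K\<^esub>x\<in>?C. w y x) = (\<Oplus>\<^bsub>K\<^esub>x\<in>(\<lambda>u. y \<otimes>\<^bsub>G\<^esub> u) ` ?C. w y x)"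
      using G.surj_const_mult[OF y] by simp
    also have "\<dots> = (\<Oplus>\<^bsub>K\<^esub>u\<in>?C. w y (y \<otimes>\<^bsub>G\<^esub> u))"
      using y by (intro K.finsum_reindex) (auto simp: w_closed intro: inj_onI)
    also have "\<dots> = (\<Oplus>\<^bsub>K\<^esub>u\<in>?C. h u \<otimes>\<^bsub>K\<^esub> k (inv\<^bsub>G\<^esub> u \<otimes>\<^bsub>G\<^esub> (inv\<^bsub>G\<^esub> y \<otimes>\<^bsub>G\<^esub> g)))"
      using y g fhk by (intro K.finsum_cong') (auto simp: w_mult)
    finally show ?thesis
      using y g fhk by (simp add: mult_KG_apply)
  qed
  have "((f \<otimes>\<^bsub>KG\<^esub> h) \<otimes>\<^bsub>KG\<^esub> k) g
      = (\<Oplus>\<^bsub>K\<^esub>x\<in>?C. (f \<otimes>\<^bsub>KG\<^esub> h) x \<otimes>\<^bsub>K\<^esub> k (inv\<^bsub>G\<^esub> x \<otimes>\<^bsub>G\<^esub> g))"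
    using fhk g by (simp add: mult_KG_apply[of "f \<otimes>\<^bsub>KG\<^esub> h"] mult_KG_closed)
  also have "\<dots> = (\<Oplus>\<^bsub>K\<^esub>x\<in>?C. \<Oplus>\<^bsub>K\<^esub>y\<in>?C. f y \<otimes>\<^bsub>K\<^esub> w y x)"
  proof (rule K.finsum_cong')
    fix x assume x: "x \<in> ?C"
    have "(f \<otimes>\<^bsub>KG\<^esub> h) x \<otimes>\<^bsub>K\<^esub> k (inv\<^bsub>G\<^esub> x \<otimes>\<^bsub>G\<^esub> g)
        = (\<Oplus>\<^bsub>K\<^esub>y\<in>?C. f y \<otimes>\<^bsub>K\<^esub> h (inv\<^bsub>G\<^esub> y \<otimes>\<^bsub>G\<^esub> x) \<otimes>\<^bsub>K\<^esub> k (inv\<^bsub>G\<^esub> x \<otimes>\<^bsub>G\<^esub> g))"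
      unfolding mult_KG_apply[OF fhk(1,2) x]
      by (rule K.finsum_ldistr) (use fhk x g finite_G in auto)
    also have "\<dots> = (\<Oplus>\<^bsub>K\<^esub>y\<in>?C. f y \<otimes>\<^bsub>K\<^esub> w y x)"
      using fhk x g w_closed
      by (intro K.finsum_cong' refl) (auto simp: w_def K.m_assoc)
    finally show "(f \<otimes>\<^bsub>KG\<^esub> h) x \<otimes>\<^bsub>K\<^esub> k (inv\<^bsub>G\<^esub> x \<otimes>\<^bsub>G\<^esub> g) = (\<Oplus>\<^bsub>K\<^esub>y\<in>?C. f y \<otimes>\<^bsub>K\<^esub> w y x)" .
  qed (use fhk w_closed in \<open>auto intro!: K.finsum_closed\<close>)
  also have "\<dots> = (\<Oplus>\<^bsub>K\<^esub>y\<in>?C. \<Oplus>\<^bsub>K\<^esub>x\<in>?C. f y \<otimes>\<^bsub>K\<^esub> w y x)"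
    using fhk w_closed finite_G by (intro K.finsum_swap) auto
  also have "\<dots> = (\<Oplus>\<^bsub>K\<^esub>y\<in>?C. f y \<otimes>\<^bsub>K\<^esub> (h \<otimes>\<^bsub>KG\<^esub> k) (inv\<^bsub>G\<^esub> y \<otimes>\<^bsub>G\<^esub> g))"
  proof (rule K.finsum_cong')
    fix y assume y: "y \<in> ?C"
    have "f y \<otimes>\<^bsub>K\<^esub> (\<Oplus>\<^bsub>K\<^esub>x\<in>?C. w y x) = (\<Oplus>\<^bsub>K\<^esub>x\<in>?C. f y \<otimes>\<^bsub>K\<^esub> w y x)"
      by (rule K.finsum_rdistr) (use fhk y w_closed finite_G in auto)
    then show "(\<Oplus>\<^bsub>K\<^esub>x\<in>?C. f y \<otimes>\<^bsub>K\<^esub> w y x) = f y \<otimes>\<^bsub>K\<^esub> (h \<otimes>\<^bsub>KG\<^esub> k) (inv\<^bsub>G\<^esub> y \<otimes>\<^bsub>G\<^esub> g)"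
      using sum_w[OF y] by simp
  qed (use fhk g in \<open>auto simp: mult_KG_closed\<close>)
  also have "\<dots> = (f \<otimes>\<^bsub>KG\<^esub> (h \<otimes>\<^bsub>KG\<^esub> k)) g"
    using fhk g by (simp add: mult_KG_apply[of f] mult_KG_closed)
  finally show "((f \<otimes>\<^bsub>KG\<^esub> h) \<otimes>\<^bsub>KG\<^esub> k) g = (f \<otimes>\<^bsub>KG\<^esub> (h \<otimes>\<^bsub>KG\<^esub> k)) g" .
qed (use fhk in \<open>simp_all add: mult_KG_closed\<close>)

lemma mult_one_KG:
  assumes f: "f \<in> carrier KG"
  shows "f \<otimes>\<^bsub>KG\<^esub> \<one>\<^bsub>KG\<^esub> = f"
proof (rule KG_eqI)
  fix g assume g: "g \<in> carrier G"
  have iff: "inv\<^bsub>G\<^esub> y \<otimes>\<^bsub>G\<^esub> g = \<one>\<^bsub>G\<^esub> \<longleftrightarrow> y = g" if "y \<in> carrier G" for y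
    using that g by (metis G.inv_closed G.inv_equality G.inv_inv G.l_inv)
  have "(f \<otimes>\<^bsub>KG\<^esub> \<one>\<^bsub>KG\<^esub>) g = (\<Oplus>\<^bsub>K\<^esub>y\<in>carrier G. if y = g then f y else \<zero>\<^bsub>K\<^esub>)"
    unfolding one_KG mult_KG_apply[OF f basis_closed g]
    using f g by (intro K.finsum_cong') (auto simp: basis_apply iff)
  also have "\<dots> = f g"
    using f g by (intro finsum_delta) auto
  finally show "(f \<otimes>\<^bsub>KG\<^esub> \<one>\<^bsub>KG\<^esub>) g = f g" .
qed (use f in \<open>auto simp: one_KG intro: KG_closures\<close>)

lemma one_mult_KG:
  assumes f: "f \<in> carrier KG"
  shows "\<one>\<^bsub>KG\<^esub> \<otimes>\<^bsub>KG\<^esub> f = f"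
  using f by (intro KG_eqI) (auto simp: one_KG basis_mult_apply intro: KG_closures)

lemma abelian_group_KG: "abelian_group KG"
proof (rule abelian_groupI)
  fix f h k assume fhk: "f \<in> carrier KG" "h \<in> carrier KG" "k \<in> carrier KG"
  show "f \<oplus>\<^bsub>KG\<^esub> h \<oplus>\<^bsub>KG\<^esub> k = f \<oplus>\<^bsub>KG\<^esub> (h \<oplus>\<^bsub>KG\<^esub> k)"
    by (rule KG_eqI) (use fhk in \<open>simp_all add: KG_closures add_KG_apply K.a_assoc\<close>)
next
  fix f h assume fh: "f \<in> carrier KG" "h \<in> carrier KG"
  show "f \<oplus>\<^bsub>KG\<^esub> h = h \<oplus>\<^bsub>KG\<^esub> f"
    by (rule KG_eqI) (use fh in \<open>auto simp: KG_closures add_KG_apply intro: K.a_comm\<close>)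
next
  fix f assume f: "f \<in> carrier KG"
  show "\<zero>\<^bsub>KG\<^esub> \<oplus>\<^bsub>KG\<^esub> f = f"
    by (rule KG_eqI) (use f in \<open>simp_all add: KG_closures add_KG_apply zero_KG_apply\<close>)
  show "\<exists>h\<in>carrier KG. h \<oplus>\<^bsub>KG\<^esub> f = \<zero>\<^bsub>KG\<^esub>"
  proof
    show "(\<ominus>\<^bsub>K\<^esub> \<one>\<^bsub>K\<^esub>) \<odot>\<^bsub>KG\<^esub> f \<oplus>\<^bsub>KG\<^esub> f = \<zero>\<^bsub>KG\<^esub>"
      by (rule KG_eqI)
        (use f in \<open>simp_all add: KG_closures add_KG_apply zero_KG_apply smult_KG_apply
          K.l_minus K.l_neg\<close>)
  qed (use f in \<open>simp add: KG_closures\<close>)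
qed (auto simp add: KG_closures)

lemma ring_KG: "ring KG"
proof (rule ringI)
  show "abelian_group KG"
    by (rule abelian_group_KG)
  show "monoid KG"
    by (rule monoidI) (simp_all add: mult_KG_closed mult_KG_assoc mult_one_KG one_mult_KG, simp add: one_KG)
next
  fix f h k assume fhk: "f \<in> carrier KG" "h \<in> carrier KG" "k \<in> carrier KG"
  show "(f \<oplus>\<^bsub>KG\<^esub> h) \<otimes>\<^bsub>KG\<^esub> k = f \<otimes>\<^bsub>KG\<^esub> k \<oplus>\<^bsub>KG\<^esub> h \<otimes>\<^bsub>KG\<^esub> k"
  proof (rule KG_eqI)
    fix g assume g: "g \<in> carrier G"
    show "((f \<oplus>\<^bsub>KG\<^esub> h) \<otimes>\<^bsub>KG\<^esub> k) g = (f \<otimes>\<^bsub>KG\<^esub> k \<oplus>\<^bsub>KG\<^esub> h \<otimes>\<^bsub>KG\<^esub> k) g"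
    proof -
      have "((f \<oplus>\<^bsub>KG\<^esub> h) \<otimes>\<^bsub>KG\<^esub> k) g
          = (\<Oplus>\<^bsub>K\<^esub>x\<in>carrier G. f x \<otimes>\<^bsub>K\<^esub> k (inv\<^bsub>G\<^esub> x \<otimes>\<^bsub>G\<^esub> g) \<oplus>\<^bsub>K\<^esub> h x \<otimes>\<^bsub>K\<^esub> k (inv\<^bsub>G\<^esub> x \<otimes>\<^bsub>G\<^esub> g))"
        unfolding mult_KG_apply[OF add_KG_closed[OF fhk(1,2)] fhk(3) g]
        using fhk g by (intro K.finsum_cong') (auto simp: add_KG_apply K.l_distr)
      also have "\<dots> = (f \<otimes>\<^bsub>KG\<^esub> k) g \<oplus>\<^bsub>K\<^esub> (h \<otimes>\<^bsub>KG\<^esub> k) g"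
        unfolding mult_KG_apply[OF fhk(1,3) g] mult_KG_apply[OF fhk(2,3) g]
        using fhk g by (intro K.finsum_addf) auto
      finally show ?thesis
        by (simp add: add_KG_apply[OF g])
    qed
  qed (use fhk in \<open>simp_all add: KG_closures\<close>)
  show "k \<otimes>\<^bsub>KG\<^esub> (f \<oplus>\<^bsub>KG\<^esub> h) = k \<otimes>\<^bsub>KG\<^esub> f \<oplus>\<^bsub>KG\<^esub> k \<otimes>\<^bsub>KG\<^esub> h"
  proof (rule KG_eqI)
    fix g assume g: "g \<in> carrier G"
    show "(k \<otimes>\<^bsub>KG\<^esub> (f \<oplus>\<^bsub>KG\<^esub> h)) g = (k \<otimes>\<^bsub>KG\<^esub> f \<oplus>\<^bsub>KG\<^esub> k \<otimes>\<^bsub>KG\<^esub> h) g"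
    proof -
      have "(k \<otimes>\<^bsub>KG\<^esub> (f \<oplus>\<^bsub>KG\<^esub> h)) g
          = (\<Oplus>\<^bsub>K\<^esub>x\<in>carrier G. k x \<otimes>\<^bsub>K\<^esub> f (inv\<^bsub>G\<^esub> x \<otimes>\<^bsub>G\<^esub> g) \<oplus>\<^bsub>K\<^esub> k x \<otimes>\<^bsub>K\<^esub> h (inv\<^bsub>G\<^esub> x \<otimes>\<^bsub>G\<^esub> g))"
        unfolding mult_KG_apply[OF fhk(3) add_KG_closed[OF fhk(1,2)] g]
        using fhk g by (intro K.finsum_cong') (auto simp: add_KG_apply K.r_distr)
      also have "\<dots> = (k \<otimes>\<^bsub>KG\<^esub> f) g \<oplus>\<^bsub>K\<^esub> (k \<otimes>\<^bsub>KG\<^esub> h) g"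
        unfolding mult_KG_apply[OF fhk(3,1) g] mult_KG_apply[OF fhk(3,2) g]
        using fhk g by (intro K.finsum_addf) auto
      finally show ?thesis
        by (simp add: add_KG_apply[OF g])
    qed
  qed (use fhk in \<open>simp_all add: KG_closures\<close>)
qed

lemma module_KG: "module K KG"
proof -
  interpret KG: abelian_group KG by (rule abelian_group_KG)
  show ?thesis
  proof (intro module.intro module_axioms.intro K.is_cring abelian_group_KG)
    fix a b f h assume ab: "a \<in> carrier K" "b \<in> carrier K"
      and fh: "f \<in> carrier KG" "h \<in> carrier KG"
    show "(a \<oplus>\<^bsub>K\<^esub> b) \<odot>\<^bsub>KG\<^esub> f = a \<odot>\<^bsub>KG\<^esub> f \<oplus>\<^bsub>KG\<^esub> b \<odot>\<^bsub>KG\<^esub> f"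
      by (rule KG_eqI)
        (use ab fh in \<open>simp_all add: KG_closures add_KG_apply smult_KG_apply K.l_distr\<close>)
    show "a \<odot>\<^bsub>KG\<^esub> (f \<oplus>\<^bsub>KG\<^esub> h) = a \<odot>\<^bsub>KG\<^esub> f \<oplus>\<^bsub>KG\<^esub> a \<odot>\<^bsub>KG\<^esub> h"
      by (rule KG_eqI)
        (use ab fh in \<open>simp_all add: KG_closures add_KG_apply smult_KG_apply K.r_distr\<close>)
    show "(a \<otimes>\<^bsub>K\<^esub> b) \<odot>\<^bsub>KG\<^esub> f = a \<odot>\<^bsub>KG\<^esub> (b \<odot>\<^bsub>KG\<^esub> f)"
      by (rule KG_eqI)
        (use ab fh in \<open>simp_all add: KG_closures smult_KG_apply K.m_assoc\<close>)
  next
    fix f assume f: "f \<in> carrier KG"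
    show "\<one>\<^bsub>K\<^esub> \<odot>\<^bsub>KG\<^esub> f = f"
      by (rule KG_eqI) (use f in \<open>simp_all add: KG_closures smult_KG_apply\<close>)
  qed (simp_all add: KG_closures)
qed

lemma associative_algebra_KG: "associative_algebra K KG"
proof (intro associative_algebra.intro associative_algebra_axioms.intro module_KG ring_KG)
  fix a f h assume afh: "a \<in> carrier K" "f \<in> carrier KG" "h \<in> carrier KG"
  show "(a \<odot>\<^bsub>KG\<^esub> f) \<otimes>\<^bsub>KG\<^esub> h = a \<odot>\<^bsub>KG\<^esub> (f \<otimes>\<^bsub>KG\<^esub> h)"
  proof (rule KG_eqI)
    fix g assume g: "g \<in> carrier G"
    show "((a \<odot>\<^bsub>KG\<^esub> f) \<otimes>\<^bsub>KG\<^esub> h) g = (a \<odot>\<^bsub>KG\<^esub> (f \<otimes>\<^bsub>KG\<^esub> h)) g"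
    proof -
      have "((a \<odot>\<^bsub>KG\<^esub> f) \<otimes>\<^bsub>KG\<^esub> h) g
          = (\<Oplus>\<^bsub>K\<^esub>x\<in>carrier G. a \<otimes>\<^bsub>K\<^esub> (f x \<otimes>\<^bsub>K\<^esub> h (inv\<^bsub>G\<^esub> x \<otimes>\<^bsub>G\<^esub> g)))"
        unfolding mult_KG_apply[OF smult_KG_closed[OF afh(1,2)] afh(3) g]
        using afh g by (intro K.finsum_cong') (auto simp: smult_KG_apply K.m_assoc)
      also have "\<dots> = a \<otimes>\<^bsub>K\<^esub> (f \<otimes>\<^bsub>KG\<^esub> h) g"
        unfolding mult_KG_apply[OF afh(2,3) g]
        by (rule K.finsum_rdistr[symmetric]) (use afh g finite_G in auto)
      finally show ?thesis
        by (simp add: smult_KG_apply[OF g])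
    qed
  qed (use afh in \<open>simp_all add: KG_closures\<close>)
  show "f \<otimes>\<^bsub>KG\<^esub> (a \<odot>\<^bsub>KG\<^esub> h) = a \<odot>\<^bsub>KG\<^esub> (f \<otimes>\<^bsub>KG\<^esub> h)"
  proof (rule KG_eqI)
    fix g assume g: "g \<in> carrier G"
    show "(f \<otimes>\<^bsub>KG\<^esub> (a \<odot>\<^bsub>KG\<^esub> h)) g = (a \<odot>\<^bsub>KG\<^esub> (f \<otimes>\<^bsub>KG\<^esub> h)) g"
    proof -
      have "(f \<otimes>\<^bsub>KG\<^esub> (a \<odot>\<^bsub>KG\<^esub> h)) g
          = (\<Oplus>\<^bsub>K\<^esub>x\<in>carrier G. a \<otimes>\<^bsub>K\<^esub> (f x \<otimes>\<^bsub>K\<^esub> h (inv\<^bsub>G\<^esub> x \<otimes>\<^bsub>G\<^esub> g)))"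
        unfolding mult_KG_apply[OF afh(2) smult_KG_closed[OF afh(1,3)] g]
        using afh g by (intro K.finsum_cong') (auto simp: smult_KG_apply K.m_lcomm)
      also have "\<dots> = a \<otimes>\<^bsub>K\<^esub> (f \<otimes>\<^bsub>KG\<^esub> h) g"
        unfolding mult_KG_apply[OF afh(2,3) g]
        by (rule K.finsum_rdistr[symmetric]) (use afh g finite_G in auto)
      finally show ?thesis
        by (simp add: smult_KG_apply[OF g])
    qed
  qed (use afh in \<open>simp_all add: KG_closures\<close>)
qed

end

section \<open>Linear extension of maps from a group to its group algebra\<close>

context associative_algebra begin

lemma finsum_smult_left:
  assumes "finite S" "x \<in> carrier A" "f \<in> S \<rightarrow> carrier K"
  shows "(\<Oplus>\<^bsub>K\<^esub>i\<in>S. f i) \<odot>\<^bsub>A\<^esub> x = (\<Oplus>\<^bsub>A\<^esub>i\<in>S. f i \<odot>\<^bsub>A\<^esub> x)"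
  using assms(1,3)
proof (induction S rule: finite_induct)
  case empty
  then show ?case using assms(2) by simp
next
  case (insert i S)
  then have "f i \<in> carrier K" "f \<in> S \<rightarrow> carrier K" "(\<Oplus>\<^bsub>K\<^esub>i\<in>S. f i) \<in> carrier K"
    "(\<lambda>i. f i \<odot>\<^bsub>A\<^esub> x) \<in> S \<rightarrow> carrier A"
    using assms(2) by auto
  with insert assms(2) show ?case
    by (simp add: smult_l_distr)
qed

end

context finite_group_algebra begin

definition linear_extension :: "('k, 'a, 'y) module_scheme \<Rightarrow> ('g \<Rightarrow> 'a) \<Rightarrow> ('g \<Rightarrow> 'k) \<Rightarrow> 'a" where
  "linear_extension A \<theta> f = (\<Oplus>\<^bsub>A\<^esub>g\<in>carrier G. f g \<odot>\<^bsub>A\<^esub> \<theta> g)"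

lemma linear_extension_closed:
  assumes "associative_algebra K A" "\<theta> \<in> carrier G \<rightarrow> carrier A" "f \<in> carrier KG"
  shows "linear_extension A \<theta> f \<in> carrier A"
proof -
  interpret A: associative_algebra K A by fact
  show ?thesis
    unfolding linear_extension_def using assms(2,3) by (intro A.finsum_closed) auto
qed

lemma linear_extension_add:
  assumes "associative_algebra K A" "\<theta> \<in> carrier G \<rightarrow> carrier A" "f \<in> carrier KG" "h \<in> carrier KG"
  shows "linear_extension A \<theta> (f \<oplus>\<^bsub>KG\<^esub> h) = linear_extension A \<theta> f \<oplus>\<^bsub>A\<^esub> linear_extension A \<theta> h"
proof -
  interpret A: associative_algebra K A by fact
  have "linear_extension A \<theta> (f \<oplus>\<^bsub>KG\<^esub> h)
      = (\<Oplus>\<^bsub>A\<^esub>g\<in>carrier G. f g \<odot>\<^bsub>A\<^esub> \<theta> g \<oplus>\<^bsub>A\<^esub> h g \<odot>\<^bsub>A\<^esub> \<theta> g)"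
    unfolding linear_extension_def using assms(2-)
    by (intro A.finsum_cong') (auto simp: add_KG_apply A.smult_l_distr Pi_iff)
  also have "\<dots> = linear_extension A \<theta> f \<oplus>\<^bsub>A\<^esub> linear_extension A \<theta> h"
    unfolding linear_extension_def using assms(2-) by (intro A.finsum_addf) auto
  finally show ?thesis .
qed

lemma linear_extension_smult:
  assumes "associative_algebra K A" "\<theta> \<in> carrier G \<rightarrow> carrier A" "a \<in> carrier K" "f \<in> carrier KG"
  shows "linear_extension A \<theta> (a \<odot>\<^bsub>KG\<^esub> f) = a \<odot>\<^bsub>A\<^esub> linear_extension A \<theta> f"
proof -
  interpret A: associative_algebra K A by fact
  have "linear_extension A \<theta> (a \<odot>\<^bsub>KG\<^esub> f) = (\<Oplus>\<^bsub>A\<^esub>g\<in>carrier G. a \<odot>\<^bsub>A\<^esub> (f g \<odot>\<^bsub>A\<^esub> \<theta> g))"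
    unfolding linear_extension_def using assms(2-)
    by (intro A.finsum_cong') (auto simp: smult_KG_apply A.smult_assoc1 Pi_iff)
  also have "\<dots> = a \<odot>\<^bsub>A\<^esub> linear_extension A \<theta> f"
    unfolding linear_extension_def
    by (rule A.finsum_smult_ldistr[symmetric]) (use assms(2-) finite_G in auto)
  finally show ?thesis .
qed

lemma linear_extension_basis:
  assumes "associative_algebra K A" "\<theta> \<in> carrier G \<rightarrow> carrier A" "x \<in> carrier G"
  shows "linear_extension A \<theta> (basis x) = \<theta> x"
proof -
  interpret A: associative_algebra K A by fact
  have "linear_extension A \<theta> (basis x) = (\<Oplus>\<^bsub>A\<^esub>g\<in>carrier G. if x = g then \<theta> g else \<zero>\<^bsub>A\<^esub>)"
    unfolding linear_extension_def using assms(2,3)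
    by (intro A.finsum_cong') (auto simp: basis_apply Pi_iff)
  also have "\<dots> = \<theta> x"
    using assms(2,3) finite_G by (intro A.finsum_singleton) auto
  finally show ?thesis .
qed

text \<open>Both sides are sums over pairs of group elements. The substitution
  \<open>u = x y\<close> turns the product of two sums into the convolution, and multiplicativity of
  \<open>\<theta>\<close> matches the terms.\<close>

lemma linear_extension_mult:
  assumes A: "associative_algebra K A" and \<theta>: "\<theta> \<in> carrier G \<rightarrow> carrier A"
    and \<theta>_mult: "\<And>x y. \<lbrakk>x \<in> carrier G; y \<in> carrier G\<rbrakk> \<Longrightarrow> \<theta> (x \<otimes>\<^bsub>G\<^esub> y) = \<theta> x \<otimes>\<^bsub>A\<^esub> \<theta> y"
    and f: "f \<in> carrier KG" and h: "h \<in> carrier KG"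
  shows "linear_extension A \<theta> (f \<otimes>\<^bsub>KG\<^esub> h) = linear_extension A \<theta> f \<otimes>\<^bsub>A\<^esub> linear_extension A \<theta> h"
proof -
  interpret A: associative_algebra K A by fact
  let ?C = "carrier G"
  define w where "w = (\<lambda>x u. (f x \<otimes>\<^bsub>K\<^esub> h (inv\<^bsub>G\<^esub> x \<otimes>\<^bsub>G\<^esub> u)) \<odot>\<^bsub>A\<^esub> \<theta> u)"
  have \<theta>_closed [simp]: "\<theta> x \<in> carrier A" if "x \<in> ?C" for x
    using \<theta> that by auto
  have w_closed: "w x u \<in> carrier A" if "x \<in> ?C" "u \<in> ?C" for x u
    using that f h by (simp add: w_def)
  have sum_w: "(f x \<odot>\<^bsub>A\<^esub> \<theta> x) \<otimes>\<^bsub>A\<^esub> linear_extension A \<theta> h = (\<Oplus>\<^bsub>A\<^esub>u\<in>?C. w x u)"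
    if x: "x \<in> ?C" for x
  proof -
    have w_mult: "w x (x \<otimes>\<^bsub>G\<^esub> y) = (f x \<odot>\<^bsub>A\<^esub> \<theta> x) \<otimes>\<^bsub>A\<^esub> (h y \<odot>\<^bsub>A\<^esub> \<theta> y)" if y: "y \<in> ?C" for y
    proof -
      have "inv\<^bsub>G\<^esub> x \<otimes>\<^bsub>G\<^esub> (x \<otimes>\<^bsub>G\<^esub> y) = y"
        using x y by (simp add: G.m_assoc[symmetric])
      then show ?thesis
        using x y f h
        by (simp add: w_def \<theta>_mult A.smult_mult_left A.smult_mult_right A.smult_assoc1[symmetric]
            K.m_comm)
    qed
    have "(f x \<odot>\<^bsub>A\<^esub> \<theta> x) \<otimes>\<^bsub>A\<^esub> linear_extension A \<theta> h
        = (\<Oplus>\<^bsub>A\<^esub>y\<in>?C. (f x \<odot>\<^bsub>A\<^esub> \<theta> x) \<otimes>\<^bsub>A\<^esub> (h y \<odot>\<^bsub>A\<^esub> \<theta> y))"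
      unfolding linear_extension_def using x f h finite_G by (intro A.finsum_rdistr) auto
    also have "\<dots> = (\<Oplus>\<^bsub>A\<^esub>y\<in>?C. w x (x \<otimes>\<^bsub>G\<^esub> y))"
      using x f h w_closed by (intro A.finsum_cong') (auto simp: w_mult linear_extension_closed)
    also have "\<dots> = (\<Oplus>\<^bsub>A\<^esub>u\<in>(\<lambda>y. x \<otimes>\<^bsub>G\<^esub> y) ` ?C. w x u)"
      using x by (intro A.finsum_reindex[symmetric]) (auto simp: w_closed intro: inj_onI)
    finally show ?thesis
      using G.surj_const_mult[OF x] by simp
  qed
  have "linear_extension A \<theta> f \<otimes>\<^bsub>A\<^esub> linear_extension A \<theta> h
      = (\<Oplus>\<^bsub>A\<^esub>x\<in>?C. (f x \<odot>\<^bsub>A\<^esub> \<theta> x) \<otimes>\<^bsub>A\<^esub> linear_extension A \<theta> h)"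
    unfolding linear_extension_def[of A \<theta> f]
    by (rule A.finsum_ldistr) (use f linear_extension_closed[OF A \<theta> h] finite_G in auto)
  also have "\<dots> = (\<Oplus>\<^bsub>A\<^esub>x\<in>?C. \<Oplus>\<^bsub>A\<^esub>u\<in>?C. w x u)"
    using w_closed by (intro A.finsum_cong') (auto simp: sum_w intro!: A.finsum_closed)
  also have "\<dots> = (\<Oplus>\<^bsub>A\<^esub>u\<in>?C. \<Oplus>\<^bsub>A\<^esub>x\<in>?C. w x u)"
    using w_closed finite_G by (intro A.finsum_swap) auto
  also have "\<dots> = linear_extension A \<theta> (f \<otimes>\<^bsub>KG\<^esub> h)"
    unfolding linear_extension_def
  proof (rule A.finsum_cong')
    fix u assume u: "u \<in> ?C"
    show "(\<Oplus>\<^bsub>A\<^esub>x\<in>?C. w x u) = (f \<otimes>\<^bsub>KG\<^esub> h) u \<odot>\<^bsub>A\<^esub> \<theta> u"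
      unfolding w_def mult_KG_apply[OF f h u]
      by (rule A.finsum_smult_left[symmetric]) (use f h u finite_G in auto)
  qed (use f h in \<open>auto simp: mult_KG_closed\<close>)
  finally show ?thesis by simp
qed

lemma linear_extension_one:
  assumes "associative_algebra K A" "\<theta> \<in> carrier G \<rightarrow> carrier A" "\<theta> \<one>\<^bsub>G\<^esub> = \<one>\<^bsub>A\<^esub>"
  shows "linear_extension A \<theta> \<one>\<^bsub>KG\<^esub> = \<one>\<^bsub>A\<^esub>"
  using linear_extension_basis[OF assms(1,2) G.one_closed] assms(3) by (simp add: one_KG)

lemma finsum_KG_apply:
  assumes "F \<in> S \<rightarrow> carrier KG" "g \<in> carrier G"
  shows "(\<Oplus>\<^bsub>KG\<^esub>i\<in>S. F i) g = (\<Oplus>\<^bsub>K\<^esub>i\<in>S. F i g)"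
proof -
  interpret KG: ring KG by (rule ring_KG)
  show ?thesis
    using assms(1)
  \<comment> \<open>For infinite \<open>S\<close> both sums take the default value zero.\<close>
  proof (induction S rule: infinite_finite_induct)
    case (insert i S)
    then have "F i \<in> carrier KG" "F \<in> S \<rightarrow> carrier KG" "(\<lambda>i. F i g) \<in> S \<rightarrow> carrier K"
      using KG_closed[OF _ assms(2)] by (auto simp: Pi_iff)
    with insert assms(2) show ?case
      by (simp add: add_KG_apply)
  qed (use assms(2) in \<open>simp_all add: zero_KG_apply\<close>)
qed

text \<open>Expresses that the group elements span the group algebra. Surjectivity onto a group
  algebra can therefore be tested on group elements.\<close>

lemma linear_extension_id:
  assumes "f \<in> carrier KG"
  shows "linear_extension KG basis f = f"
proof (rule KG_eqI)
  interpret A: associative_algebra K KG by (rule associative_algebra_KG)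
  show "linear_extension KG basis f \<in> carrier KG"
    using assms by (intro linear_extension_closed associative_algebra_KG) auto
  fix g assume g: "g \<in> carrier G"
  have "linear_extension KG basis f g = (\<Oplus>\<^bsub>K\<^esub>x\<in>carrier G. (f x \<odot>\<^bsub>KG\<^esub> basis x) g)"
    unfolding linear_extension_def using assms g
    by (intro finsum_KG_apply) (auto simp: smult_KG_closed)
  also have "\<dots> = (\<Oplus>\<^bsub>K\<^esub>x\<in>carrier G. if x = g then f x else \<zero>\<^bsub>K\<^esub>)"
    using assms g by (intro K.finsum_cong') (auto simp: smult_KG_apply basis_apply)
  also have "\<dots> = f g"
    using assms g by (intro finsum_delta) auto
  finally show "linear_extension KG basis f g = f g" .
qed (fact assms)

text \<open>The inverse of \<open>basis x\<close> is \<open>basis\<close> of the inverse of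
  \<open>x\<close>. Through this map relations between group elements become relations between units
  of the algebra.\<close>

lemma basis_hom_units: "basis \<in> hom G (units_of KG)"
proof (rule homI)
  fix x assume x: "x \<in> carrier G"
  interpret KG: ring KG by (rule ring_KG)
  have "basis x \<otimes>\<^bsub>KG\<^esub> basis (inv\<^bsub>G\<^esub> x) = \<one>\<^bsub>KG\<^esub>" "basis (inv\<^bsub>G\<^esub> x) \<otimes>\<^bsub>KG\<^esub> basis x = \<one>\<^bsub>KG\<^esub>"
    using x by (simp_all add: basis_mult one_KG)
  then show "basis x \<in> carrier (units_of KG)"
    unfolding units_of_carrier Units_def using basis_closed by blast
qed (simp add: units_of_mult basis_mult)

end

text \<open>The image of the extended map is closed under products and linear combinations. Once it
  contains the generators \<open>S\<close>, it contains all of \<open>H\<close>, which spans. Equal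
  orders give both algebras the same finite cardinality, so the surjection is a bijection.\<close>

lemma algebras_isomorphic_if_generators_in_image:
  assumes G: "finite_group_algebra K G" and H: "finite_group_algebra K H"
    and fin: "finite (carrier K)" and ord: "order G = order H"
    and \<theta>: "\<theta> \<in> hom G (units_of (group_algebra K H))"
    and gen: "carrier H = generate H S" "S \<subseteq> carrier H"
    and img: "\<And>s. s \<in> S \<Longrightarrow> finite_group_algebra.basis K H s
      \<in> finite_group_algebra.linear_extension G (group_algebra K H) \<theta> ` carrier (group_algebra K G)"
  shows "algebras_isomorphic K (group_algebra K G) (group_algebra K H)"
proof -
  interpret G: finite_group_algebra K G by fact
  interpret H: finite_group_algebra K H by fact
  interpret KG: associative_algebra K G.KG by (rule G.associative_algebra_KG)
  interpret KH: associative_algebra K H.KG by (rule H.associative_algebra_KG)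
  interpret \<theta>: group_hom G "units_of H.KG" \<theta>
    using \<theta> KH.units_group G.G.group_axioms by (simp add: group_hom_def group_hom_axioms_def)
  define \<phi> where "\<phi> = G.linear_extension H.KG \<theta>"
  note KH = H.associative_algebra_KG
  have \<theta>_closed: "\<theta> \<in> carrier G \<rightarrow> carrier H.KG"
    using \<theta>.hom_closed by (auto simp: units_of_carrier)
  have \<phi>_mult: "\<phi> (f \<otimes>\<^bsub>G.KG\<^esub> h) = \<phi> f \<otimes>\<^bsub>H.KG\<^esub> \<phi> h" if "f \<in> carrier G.KG" "h \<in> carrier G.KG" for f h
    unfolding \<phi>_def
    using that \<theta>.hom_mult by (intro G.linear_extension_mult KH \<theta>_closed) (auto simp: units_of_mult)
  have \<phi>_closed: "\<phi> f \<in> carrier H.KG" if "f \<in> carrier G.KG" for f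
    unfolding \<phi>_def by (intro G.linear_extension_closed KH \<theta>_closed that)
  have \<phi>_add: "\<phi> (f \<oplus>\<^bsub>G.KG\<^esub> h) = \<phi> f \<oplus>\<^bsub>H.KG\<^esub> \<phi> h" if "f \<in> carrier G.KG" "h \<in> carrier G.KG" for f h
    unfolding \<phi>_def by (intro G.linear_extension_add KH \<theta>_closed that)
  have \<phi>_smult: "\<phi> (a \<odot>\<^bsub>G.KG\<^esub> f) = a \<odot>\<^bsub>H.KG\<^esub> \<phi> f" if "a \<in> carrier K" "f \<in> carrier G.KG" for a f
    unfolding \<phi>_def by (intro G.linear_extension_smult KH \<theta>_closed that)
  have \<phi>_one: "\<phi> \<one>\<^bsub>G.KG\<^esub> = \<one>\<^bsub>H.KG\<^esub>"
    unfolding \<phi>_def using \<theta>.hom_one by (intro G.linear_extension_one KH \<theta>_closed) (simp add: units_of_one)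
  define I where "I = \<phi> ` carrier G.KG"
  have I_mult: "u \<otimes>\<^bsub>H.KG\<^esub> v \<in> I" if "u \<in> I" "v \<in> I" for u v
    using that \<phi>_mult KG.m_closed unfolding I_def by (auto simp flip: \<phi>_mult)
  have I_one: "\<one>\<^bsub>H.KG\<^esub> \<in> I"
    using \<phi>_one KG.one_closed unfolding I_def by (metis imageI)
  have basis_pow: "H.basis (h [^]\<^bsub>H\<^esub> (q::nat)) \<in> I" if "H.basis h \<in> I" "h \<in> carrier H" for h q
    using that by (induction q)
      (auto simp flip: H.basis_mult H.one_KG intro: I_mult I_one)
  have basis_I: "H.basis h \<in> I" if "h \<in> generate H S" for h
    using that
  proof induction
    case one
    then show ?case using I_one by (simp add: H.one_KG)
  next
    case (incl h)
    then show ?case using img by (simp add: I_def \<phi>_def)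
  next
    case (inv h)
    then have h: "h \<in> carrier H" "H.basis h \<in> I"
      using gen img by (auto simp: I_def \<phi>_def)
    \<comment> \<open>The image is not known to be closed under inverses, but in a finite group an
      inverse is a power with natural exponent.\<close>
    have "order H > 0"
      using H.finite_G H.G.order_gt_0_iff_finite by blast
    then have "h [^]\<^bsub>H\<^esub> (order H - 1) \<otimes>\<^bsub>H\<^esub> h = \<one>\<^bsub>H\<^esub>"
      using h H.G.pow_order_eq_1[of h] by (simp flip: nat_pow_Suc)
    then have "inv\<^bsub>H\<^esub> h = h [^]\<^bsub>H\<^esub> (order H - 1)"
      using h by (intro H.G.inv_equality) auto
    then show ?case using basis_pow h by simp
  next
    case (eng h1 h2)
    then show ?case
      using gen by (auto simp flip: H.basis_mult intro: I_mult)
  qed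
  have surj: "I = carrier H.KG"
  proof
    show "I \<subseteq> carrier H.KG"
      unfolding I_def using \<phi>_closed by auto
    show "carrier H.KG \<subseteq> I"
    proof
      fix f assume f: "f \<in> carrier H.KG"
      have "(\<Oplus>\<^bsub>H.KG\<^esub>h\<in>T. f h \<odot>\<^bsub>H.KG\<^esub> H.basis h) \<in> I" if "T \<subseteq> carrier H" for T
        using finite_subset[OF that H.finite_G] that
      proof (induction T rule: finite_induct)
        case empty
        have "\<phi> (\<zero>\<^bsub>K\<^esub> \<odot>\<^bsub>G.KG\<^esub> \<zero>\<^bsub>G.KG\<^esub>) = \<zero>\<^bsub>H.KG\<^esub>"
          by (subst \<phi>_smult) (auto intro!: KH.smult_l_null \<phi>_closed)
        then have "\<phi> \<zero>\<^bsub>G.KG\<^esub> = \<zero>\<^bsub>H.KG\<^esub>"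
          by simp
        then show ?case
          unfolding I_def using KG.zero_closed by (simp, metis imageI)
      next
        case (insert h T)
        obtain e where e: "e \<in> carrier G.KG" "\<phi> e = H.basis h"
          using basis_I[of h] insert.prems gen by (auto simp: I_def)
        obtain e' where e': "e' \<in> carrier G.KG" "\<phi> e' = (\<Oplus>\<^bsub>H.KG\<^esub>h\<in>T. f h \<odot>\<^bsub>H.KG\<^esub> H.basis h)"
          using insert by (auto simp: I_def)
        have fh: "f h \<in> carrier K"
          using f insert.prems by auto
        have "(\<lambda>h. f h \<odot>\<^bsub>H.KG\<^esub> H.basis h) \<in> T \<rightarrow> carrier H.KG"
          using f insert.prems by (auto intro!: KH.smult_closed H.KG_closed)
        then have "\<phi> (f h \<odot>\<^bsub>G.KG\<^esub> e \<oplus>\<^bsub>G.KG\<^esub> e')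
            = (\<Oplus>\<^bsub>H.KG\<^esub>h\<in>insert h T. f h \<odot>\<^bsub>H.KG\<^esub> H.basis h)"
          using insert.hyps fh e e' by (simp add: \<phi>_add \<phi>_smult KH.finsum_insert)
        moreover have "f h \<odot>\<^bsub>G.KG\<^esub> e \<oplus>\<^bsub>G.KG\<^esub> e' \<in> carrier G.KG"
          using e e' fh by auto
        ultimately show ?case
          unfolding I_def by (metis imageI)
      qed
      from this[OF subset_refl] show "f \<in> I"
        using H.linear_extension_id[OF f] by (simp add: H.linear_extension_def)
    qed
  qed
  have "card (carrier G.KG) = card (carrier H.KG)"
    using ord G.finite_G H.finite_G by (simp add: G.carrier_KG H.carrier_KG card_PiE order_def)
  moreover have "finite (carrier G.KG)"
    using fin G.finite_G by (simp add: G.carrier_KG finite_PiE)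
  ultimately have "bij_betw \<phi> (carrier G.KG) (carrier H.KG)"
    using surj unfolding I_def bij_betw_def by (metis eq_card_imp_inj_on)
  then have "\<phi> \<in> algebra_iso K G.KG H.KG"
    unfolding algebra_iso_def using \<phi>_mult \<phi>_closed \<phi>_add \<phi>_one \<phi>_smult
    by (auto intro!: ring_iso_memI)
  then show ?thesis
    unfolding algebras_isomorphic_def by blast
qed

section \<open>Pairs of elements with central squares\<close>

text \<open>Each square commutes with the other generator and trivially with its own root, hence
  with everything the two generate. Only monoid operations occur, so the predicate applies to a
  group, to its group algebra and to the unit group of that algebra.\<close>

definition central_square_pair :: "('g, 'x) monoid_scheme \<Rightarrow> nat \<Rightarrow> 'g \<Rightarrow> 'g \<Rightarrow> bool" where
  "central_square_pair G l x y \<longleftrightarrow> x \<in> carrier G \<and> y \<in> carrier G \<and>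
     x \<otimes>\<^bsub>G\<^esub> x \<otimes>\<^bsub>G\<^esub> y = y \<otimes>\<^bsub>G\<^esub> (x \<otimes>\<^bsub>G\<^esub> x) \<and> y \<otimes>\<^bsub>G\<^esub> y \<otimes>\<^bsub>G\<^esub> x = x \<otimes>\<^bsub>G\<^esub> (y \<otimes>\<^bsub>G\<^esub> y) \<and>
     (x \<otimes>\<^bsub>G\<^esub> y) [^]\<^bsub>G\<^esub> ((2::nat) ^ l) = (y \<otimes>\<^bsub>G\<^esub> x) [^]\<^bsub>G\<^esub> ((2::nat) ^ l)"

lemma (in monoid) nat_pow_two_power_Suc:
  "x \<in> carrier G \<Longrightarrow> x [^] ((2::nat) ^ Suc j) = (x \<otimes> x) [^] ((2::nat) ^ j)"
  using nat_pow_pow[of x 2 "2 ^ j"] by (simp add: numeral_2_eq_2)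

lemma (in monoid) commutes_mult:
  assumes "x \<in> carrier G" "y \<in> carrier G" "z \<in> carrier G"
    and "x \<otimes> y = y \<otimes> x" "x \<otimes> z = z \<otimes> x"
  shows "x \<otimes> (y \<otimes> z) = y \<otimes> z \<otimes> x"
proof -
  have "x \<otimes> (y \<otimes> z) = y \<otimes> (x \<otimes> z)"
    using assms(1-4) by (simp add: m_assoc[symmetric])
  then show ?thesis
    using assms by (simp add: m_assoc)
qed

text \<open>In each product the inner square, \<open>y y\<close> or \<open>x x\<close>, can be moved
  to the outside. So \<open>x y\<close> and \<open>y x\<close> commute, as the Frobenius map needs,
  and are inverse to each other up to a central factor.\<close>

lemma (in monoid) opposite_products_commute:
  assumes "x \<in> carrier G" "y \<in> carrier G"
    and "x \<otimes> x \<otimes> y = y \<otimes> (x \<otimes> x)" "y \<otimes> y \<otimes> x = x \<otimes> (y \<otimes> y)"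
  shows "(x \<otimes> y) \<otimes> (y \<otimes> x) = (x \<otimes> x) \<otimes> (y \<otimes> y)"
    and "(y \<otimes> x) \<otimes> (x \<otimes> y) = (x \<otimes> x) \<otimes> (y \<otimes> y)"
proof -
  have "(x \<otimes> y) \<otimes> (y \<otimes> x) = x \<otimes> (y \<otimes> y \<otimes> x)"
    using assms(1,2) by (simp add: m_assoc)
  then show "(x \<otimes> y) \<otimes> (y \<otimes> x) = (x \<otimes> x) \<otimes> (y \<otimes> y)"
    using assms by (simp add: m_assoc)
  have "(y \<otimes> x) \<otimes> (x \<otimes> y) = (y \<otimes> (x \<otimes> x)) \<otimes> y"
    using assms(1,2) by (simp add: m_assoc)
  then show "(y \<otimes> x) \<otimes> (x \<otimes> y) = (x \<otimes> x) \<otimes> (y \<otimes> y)"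
    using assms(1,2) by (simp add: assms(3)[symmetric]) (simp add: m_assoc)
qed

section \<open>Rings of characteristic 2 and the change of generators\<close>

lemma (in ring) char2_double:
  assumes "\<one> \<oplus> \<one> = \<zero>" "x \<in> carrier R"
  shows "x \<oplus> x = \<zero>"
  using assms l_distr[of \<one> \<one> x] by simp

lemma (in ring) char2_add_double:
  assumes "\<one> \<oplus> \<one> = \<zero>" "x \<in> carrier R" "y \<in> carrier R"
  shows "x \<oplus> (x \<oplus> y) = y"
  using assms char2_double[of x] by (simp add: a_assoc[symmetric])

text \<open>The two cross terms cancel on squaring, and the squares of \<open>u\<close> and
  \<open>v\<close> commute again; the induction passes from a pair to its squares.\<close>

lemma (in ring) char2_frobenius:
  assumes "\<one> \<oplus> \<one> = \<zero>" "u \<in> carrier R" "v \<in> carrier R" "u \<otimes> v = v \<otimes> u"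
  shows "(u \<oplus> v) [^] ((2::nat) ^ j) = u [^] ((2::nat) ^ j) \<oplus> v [^] ((2::nat) ^ j)"
  using assms(2-)
proof (induction j arbitrary: u v)
  case 0
  then show ?case by simp
next
  case (Suc j)
  have "(u \<oplus> v) \<otimes> (u \<oplus> v) = u \<otimes> u \<oplus> (v \<otimes> u \<oplus> (v \<otimes> u \<oplus> v \<otimes> v))"
    using Suc.prems by (simp add: l_distr r_distr a_assoc)
  also have "\<dots> = u \<otimes> u \<oplus> v \<otimes> v"
    using Suc.prems assms(1) by (simp add: char2_add_double)
  finally have sq: "(u \<oplus> v) \<otimes> (u \<oplus> v) = u \<otimes> u \<oplus> v \<otimes> v" .
  have "u \<otimes> u \<otimes> (v \<otimes> v) = v \<otimes> v \<otimes> (u \<otimes> u)"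
    using Suc.prems by (metis commutes_mult m_closed)
  then have "(u \<otimes> u \<oplus> v \<otimes> v) [^] ((2::nat) ^ j)
      = (u \<otimes> u) [^] ((2::nat) ^ j) \<oplus> (v \<otimes> v) [^] ((2::nat) ^ j)"
    using Suc.prems by (intro Suc.IH) auto
  then show ?case
    using Suc.prems by (simp only: nat_pow_two_power_Suc add.m_closed sq)
qed

lemma (in ring) central_square_pair_shift:
  assumes char2: "\<one> \<oplus> \<one> = \<zero>" and xy: "central_square_pair R l x y" and "l < m"
  shows "central_square_pair R l x (\<one> \<oplus> x \<oplus> y)"
    and "(\<one> \<oplus> x \<oplus> y) [^] ((2::nat) ^ m) = \<one> \<oplus> x [^] ((2::nat) ^ m) \<oplus> y [^] ((2::nat) ^ m)"
proof -
  have [simp]: "x \<in> carrier R" "y \<in> carrier R"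
    and xx: "x \<otimes> (x \<otimes> y) = y \<otimes> (x \<otimes> x)" and yy: "y \<otimes> (y \<otimes> x) = x \<otimes> (y \<otimes> y)"
    and pow: "(x \<otimes> y) [^] ((2::nat) ^ l) = (y \<otimes> x) [^] ((2::nat) ^ l)"
    using xy by (auto simp: central_square_pair_def m_assoc)
  note double = char2_double[OF char2] char2_add_double[OF char2]
  define s where "s = x \<otimes> y \<oplus> y \<otimes> x"
  define Y where "Y = \<one> \<oplus> x \<oplus> y"
  have [simp]: "s \<in> carrier R" "Y \<in> carrier R"
    by (simp_all add: s_def Y_def)
  \<comment> \<open>As \<open>y x x = x x y\<close>, both sides equal
    \<open>x y x + x x y\<close>.\<close>
  have sx: "s \<otimes> x = x \<otimes> s"
    by (simp add: s_def l_distr r_distr m_assoc xx a_comm)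
  have sy: "s \<otimes> y = y \<otimes> s"
    by (simp add: s_def l_distr r_distr m_assoc yy a_comm)
  \<comment> \<open>The pairs \<open>x + x\<close> and \<open>y + y\<close> cancel, which leaves
    only terms that commute with \<open>x\<close>.\<close>
  have YY: "Y \<otimes> Y = \<one> \<oplus> (x \<otimes> x \<oplus> (y \<otimes> y \<oplus> s))"
  proof -
    have "Y \<otimes> Y = \<one> \<oplus> (x \<oplus> (x \<oplus> (y \<oplus> (y \<oplus> (x \<otimes> x \<oplus> (y \<otimes> y \<oplus> s))))))"
      by (simp add: Y_def s_def l_distr r_distr a_ac)
    then show ?thesis by (simp add: double)
  qed
  have xY: "x \<otimes> Y = x \<oplus> (x \<otimes> x \<oplus> x \<otimes> y)" and Yx: "Y \<otimes> x = x \<oplus> (x \<otimes> x \<oplus> y \<otimes> x)"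
    by (simp_all add: Y_def l_distr r_distr a_assoc)
  have "x \<otimes> Y \<oplus> Y \<otimes> x = x \<oplus> (x \<oplus> (x \<otimes> x \<oplus> (x \<otimes> x \<oplus> s)))"
    unfolding xY Yx by (simp add: s_def a_ac)
  then have xY_Yx: "x \<otimes> Y \<oplus> Y \<otimes> x = s"
    by (simp add: double)
  have "x \<otimes> (y \<otimes> y) = y \<otimes> y \<otimes> x"
    using yy by (simp add: m_assoc)
  then have YYx: "Y \<otimes> Y \<otimes> x = x \<otimes> (Y \<otimes> Y)"
    unfolding YY by (simp add: l_distr r_distr m_assoc sx)
  have xxY: "x \<otimes> x \<otimes> Y = Y \<otimes> (x \<otimes> x)"
    by (simp add: Y_def l_distr r_distr m_assoc xx)
  \<comment> \<open>The summands \<open>x y\<close> and \<open>y x\<close> commute, so this power of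
    \<open>s\<close> is the sum of two equal powers.\<close>
  have s_pow: "s [^] ((2::nat) ^ l) = \<zero>"
  proof -
    have "x \<otimes> y \<otimes> (y \<otimes> x) = y \<otimes> x \<otimes> (x \<otimes> y)"
      using opposite_products_commute[of x y] xx yy by (simp add: m_assoc)
    then show ?thesis
      unfolding s_def by (subst char2_frobenius[OF char2]) (simp_all add: pow double)
  qed
  \<comment> \<open>The previous argument run backwards: \<open>x Y\<close> and \<open>Y x\<close>
    commute, and a power of their sum \<open>s\<close> vanishes, so their powers agree.\<close>
  have "(x \<otimes> Y) \<otimes> (Y \<otimes> x) = (Y \<otimes> x) \<otimes> (x \<otimes> Y)"
    using opposite_products_commute[of x Y] YYx xxY by simp
  then have "(x \<otimes> Y) [^] ((2::nat) ^ l) \<oplus> (Y \<otimes> x) [^] ((2::nat) ^ l) = \<zero>"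
    using char2_frobenius[OF char2, of "x \<otimes> Y" "Y \<otimes> x" l] by (simp add: xY_Yx s_pow)
  then have "(x \<otimes> Y) [^] ((2::nat) ^ l) = (Y \<otimes> x) [^] ((2::nat) ^ l)"
    using double(2)[of "(Y \<otimes> x) [^] ((2::nat) ^ l)" "(x \<otimes> Y) [^] ((2::nat) ^ l)"] by (simp add: a_comm)
  then show "central_square_pair R l x (\<one> \<oplus> x \<oplus> y)"
    unfolding central_square_pair_def Y_def[symmetric] using YYx xxY by simp
  \<comment> \<open>One factor 2 of the exponent \<open>2 ^ m\<close> is spent on squaring
    \<open>Y\<close>; the remaining \<open>2 ^ (l + d)\<close> still annihilates \<open>s\<close>.
    The commutation facts below allow the Frobenius map to be applied to the summands of
    \<open>Y Y\<close>.\<close>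
  obtain d where d: "m = Suc (l + d)"
    using \<open>l < m\<close> less_imp_Suc_add by blast
  have "s [^] ((2::nat) ^ (l + d)) = \<zero>"
    using nat_pow_pow[of s "2 ^ l" "2 ^ d"] by (simp add: s_pow power_add nat_pow_zero)
  moreover have "x \<otimes> x \<otimes> (y \<otimes> y \<oplus> s) = (y \<otimes> y \<oplus> s) \<otimes> (x \<otimes> x)"
  proof -
    have "x \<otimes> x \<otimes> (y \<otimes> y) = y \<otimes> y \<otimes> (x \<otimes> x)"
      using xx by (intro commutes_mult) (simp_all add: m_assoc)
    moreover have "x \<otimes> x \<otimes> s = s \<otimes> (x \<otimes> x)"
      using sx by (intro commutes_mult[symmetric]) simp_all
    ultimately show ?thesis
      by (simp add: l_distr r_distr)
  qed
  moreover have "y \<otimes> y \<otimes> s = s \<otimes> (y \<otimes> y)"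
    using sy by (intro commutes_mult[symmetric]) simp_all
  ultimately have "(Y \<otimes> Y) [^] ((2::nat) ^ (l + d))
      = \<one> \<oplus> ((x \<otimes> x) [^] ((2::nat) ^ (l + d)) \<oplus> (y \<otimes> y) [^] ((2::nat) ^ (l + d)))"
    unfolding YY by (simp add: char2_frobenius[OF char2])
  then show "(\<one> \<oplus> x \<oplus> y) [^] ((2::nat) ^ m) = \<one> \<oplus> x [^] ((2::nat) ^ m) \<oplus> y [^] ((2::nat) ^ m)"
    using nat_pow_two_power_Suc[of x "l + d"] nat_pow_two_power_Suc[of y "l + d"]
      nat_pow_two_power_Suc[of Y "l + d"]
    unfolding d Y_def[symmetric] by (simp add: a_assoc del: power_Suc)
qed

lemma (in group) inv_intertwine:
  assumes "y \<in> carrier G" "v \<in> carrier G" "w \<in> carrier G" "y \<otimes> w = v \<otimes> y"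
  shows "y \<otimes> inv w = inv v \<otimes> y"
proof -
  have "inv v \<otimes> (y \<otimes> w) \<otimes> inv w = y \<otimes> inv w"
    unfolding assms(4) using assms(1-3) by (simp add: m_assoc[symmetric])
  then show ?thesis
    using assms(1-3) by (simp add: m_assoc)
qed

text \<open>The hypothesis says that conjugation by \<open>y\<close> takes \<open>w\<close> to
  \<open>v\<close>, hence powers to powers; \<open>inv_intertwine\<close> covers negative exponents.
  The case \<open>v = w\<close> is used for commuting elements.\<close>

lemma (in group) int_pow_intertwine:
  assumes "y \<in> carrier G" "v \<in> carrier G" "w \<in> carrier G" "y \<otimes> w = v \<otimes> y"
  shows "y \<otimes> w [^] (i::int) = v [^] i \<otimes> y"
proof -
  have nat: "y \<otimes> w [^] (q::nat) = v [^] q \<otimes> y" for q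
  proof (induction q)
    case (Suc q)
    show ?case
    proof -
      have "y \<otimes> w [^] Suc q = (v [^] q \<otimes> y) \<otimes> w"
        using assms(1-3) by (simp add: Suc[symmetric] m_assoc)
      also have "\<dots> = v [^] q \<otimes> (v \<otimes> y)"
        using assms by (simp add: m_assoc)
      finally show ?thesis
        using assms(1-3) by (simp add: m_assoc)
    qed
  qed (use assms in simp)
  show ?thesis
  proof (cases i rule: int_cases)
    case (nonneg q)
    then show ?thesis by (simp add: int_pow_int nat)
  next
    case (neg q)
    have "y \<otimes> inv (w [^] Suc q) = inv (v [^] Suc q) \<otimes> y"
      using inv_intertwine[OF _ _ _ nat[of "Suc q"]] assms by blast
    then show ?thesis
      using assms neg by (simp add: int_pow_neg_int del: of_nat_Suc nat_pow_Suc)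
  qed
qed

section \<open>The twisted groups\<close>

text \<open>The character \<open>(-1) ^ t\<close>, given by cases because \<open>t\<close> may be
  negative.\<close>

definition parity_sign :: "int \<Rightarrow> int" where
  "parity_sign t = (if even t then 1 else - 1)"

lemma parity_sign_add: "parity_sign (s + t) = parity_sign s * parity_sign t"
  by (auto simp: parity_sign_def)

lemma parity_sign_minus [simp]: "parity_sign (- t) = parity_sign t"
  by (auto simp: parity_sign_def)

lemma parity_sign_square [simp]: "parity_sign t * parity_sign t = 1" "parity_sign t * (parity_sign t * u) = u"
  by (auto simp: parity_sign_def)

lemma parity_sign_0 [simp]: "parity_sign 0 = 1" and parity_sign_1 [simp]: "parity_sign 1 = - 1"
  by (auto simp: parity_sign_def)

lemma odd_parity_sign [simp]: "odd (parity_sign t)"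
  by (auto simp: parity_sign_def)

text \<open>Canonical representative of an integer triple. Calculations keep arbitrary integers
  inside \<open>reduce\<close>, and equality becomes divisibility of differences.\<close>

definition reduce :: "nat \<Rightarrow> nat \<Rightarrow> nat \<Rightarrow> int \<Rightarrow> int \<Rightarrow> int \<Rightarrow> int \<times> int \<times> int" where
  "reduce n m l i j r = (i mod 2 ^ n, j mod 2 ^ m, r mod 2 ^ Suc l)"

text \<open>For positive \<open>n\<close> and \<open>m\<close>, dropping the parity condition gives
  a semidirect product: two cyclic groups act on a third by signs. The condition cuts out a subgroup
  of index 2.\<close>

definition twisted_group :: "nat \<Rightarrow> nat \<Rightarrow> nat \<Rightarrow> int \<Rightarrow> (int \<times> int \<times> int) monoid" where
  "twisted_group n m l e =
     \<lparr>carrier = {(i, j, r). i \<in> {0..<2 ^ n} \<and> j \<in> {0..<2 ^ m} \<and> r \<in> {0..<2 ^ Suc l} \<and> even (j + r)},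
      monoid.mult = (\<lambda>(i, j, r) (i', j', r').
        reduce n m l (i + i') (j + j') (r + parity_sign (i + e * j) * r')),
      one = (0, 0, 0)\<rparr>"

text \<open>Positive exponents make the moduli \<open>2 ^ n\<close> and \<open>2 ^ m\<close> even,
  so that parities of coordinates, and with them the signs, are well defined.\<close>

locale twisted =
  fixes n m l :: nat and e :: int
  assumes n_pos: "0 < n" and m_pos: "0 < m"
begin

abbreviation T where "T \<equiv> twisted_group n m l e"
abbreviation red where "red \<equiv> reduce n m l"
abbreviation sg where "sg i j \<equiv> parity_sign (i + e * j)"

lemma even_mod [simp]:
  "even (i mod 2 ^ n) \<longleftrightarrow> even (i::int)" "even (i mod 2 ^ m) \<longleftrightarrow> even i" "even (i mod (2 * 2 ^ l)) \<longleftrightarrow> even i"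
  using n_pos m_pos by (simp_all add: dvd_mod_iff)

lemma red_closed [simp]: "even (j + r) \<Longrightarrow> red i j r \<in> carrier T"
  by (auto simp: twisted_group_def reduce_def)

lemma carrierE:
  assumes "g \<in> carrier T"
  obtains i j r where "g = red i j r" "even (j + r)" "0 \<le> i" "i < 2 ^ n"
    "0 \<le> j" "j < 2 ^ m" "0 \<le> r" "r < 2 ^ Suc l"
  using assms by (auto simp: twisted_group_def reduce_def)

lemma one_T: "\<one>\<^bsub>T\<^esub> = red 0 0 0"
  by (simp add: twisted_group_def reduce_def)

text \<open>The sign depends only on parities, which survive reduction, so products may be formed
  before reducing.\<close>

lemma mult_red: "red i j r \<otimes>\<^bsub>T\<^esub> red i' j' r' = red (i + i') (j + j') (r + sg i j * r')"
proof -
  have "sg (i mod 2 ^ n) (j mod 2 ^ m) = sg i j"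
    by (simp add: parity_sign_def)
  then show ?thesis
    by (simp add: twisted_group_def reduce_def mod_simps)
      (metis mod_add_left_eq mod_add_right_eq mod_mult_right_eq)
qed

lemma group_T: "group T"
proof (rule groupI)
  fix g h k assume "g \<in> carrier T" "h \<in> carrier T" "k \<in> carrier T"
  then show "g \<otimes>\<^bsub>T\<^esub> h \<otimes>\<^bsub>T\<^esub> k = g \<otimes>\<^bsub>T\<^esub> (h \<otimes>\<^bsub>T\<^esub> k)"
    by (elim carrierE) (simp add: mult_red parity_sign_add algebra_simps)
next
  fix g assume "g \<in> carrier T"
  then obtain i j r where g: "g = red i j r" "even (j + r)"
    by (elim carrierE)
  then have "red (- i) (- j) (- (sg i j * r)) \<otimes>\<^bsub>T\<^esub> g = \<one>\<^bsub>T\<^esub>"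
    using parity_sign_minus[of "i + e * j"] by (simp add: mult_red one_T algebra_simps)
  moreover have "red (- i) (- j) (- (sg i j * r)) \<in> carrier T"
    using g by (intro red_closed) auto
  ultimately show "\<exists>h\<in>carrier T. h \<otimes>\<^bsub>T\<^esub> g = \<one>\<^bsub>T\<^esub>"
    by blast
next
  fix g h assume "g \<in> carrier T" "h \<in> carrier T"
  then show "g \<otimes>\<^bsub>T\<^esub> h \<in> carrier T"
    by (elim carrierE) (auto simp: mult_red)
qed (auto simp: mult_red one_T elim!: carrierE)

sublocale T: group T
  by (rule group_T)

lemma inv_red:
  assumes "even (j + r)"
  shows "inv\<^bsub>T\<^esub> (red i j r) = red (- i) (- j) (- (sg i j * r))"
proof (rule T.inv_equality)
  show "red (- i) (- j) (- (sg i j * r)) \<otimes>\<^bsub>T\<^esub> red i j r = \<one>\<^bsub>T\<^esub>"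
    using parity_sign_minus[of "i + e * j"] by (simp add: mult_red one_T algebra_simps)
qed (use assms in auto)

text \<open>Under either condition the sign has no effect on \<open>r\<close>, so powers are formed
  coordinatewise.\<close>

lemma nat_pow_red:
  assumes "even (i + e * j) \<or> r = 0"
  shows "red i j r [^]\<^bsub>T\<^esub> (q::nat) = red (int q * i) (int q * j) (int q * r)"
proof (induction q)
  case 0
  then show ?case by (simp add: one_T)
next
  case (Suc q)
  have "sg (int q * i) (int q * j) * r = r"
    using assms by (auto simp: parity_sign_def)
  then show ?case
    by (auto simp: Suc mult_red algebra_simps)
qed

lemma int_pow_red:
  assumes "even (i + e * j) \<or> r = 0" "even (j + r)"
  shows "red i j r [^]\<^bsub>T\<^esub> (q::int) = red (q * i) (q * j) (q * r)"
proof (cases q rule: int_cases)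
  case (nonneg k)
  then show ?thesis using assms(1) by (simp add: int_pow_int nat_pow_red)
next
  case (neg k)
  have "sg (int (Suc k) * i) (int (Suc k) * j) * r = r"
    using assms(1) by (auto simp: parity_sign_def)
  then have "sg (int (Suc k) * i) (int (Suc k) * j) * (int (Suc k) * r) = int (Suc k) * r"
    by (metis mult.left_commute)
  then show ?thesis
    unfolding neg T.int_pow_neg_int[OF red_closed[OF assms(2)]] nat_pow_red[OF assms(1)]
    using assms(2) by (subst inv_red) (auto simp del: of_nat_Suc)
qed

lemma red_eq_iff:
  "red i j r = red i' j' r' \<longleftrightarrow>
    2 ^ n dvd i - i' \<and> 2 ^ m dvd j - j' \<and> 2 ^ Suc l dvd r - r'"
  by (simp add: reduce_def mod_eq_dvd_iff)

section \<open>Order and commutator subgroup of the twisted groups\<close>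

lemma order_T: "order T = 2 ^ (n + m + l)"
proof -
  define A where "A = {0..<2 ^ n :: int} \<times> {0..<2 ^ m :: int} \<times> {0..<2 ^ l :: int}"
  \<comment> \<open>The parity of \<open>r\<close> is that of \<open>j\<close>, so only
    \<open>r div 2\<close> is free; hence the factor \<open>2 ^ l\<close> instead of
    \<open>2 ^ Suc l\<close>.\<close>
  define pack :: "int \<times> int \<times> int \<Rightarrow> int \<times> int \<times> int"
    where "pack = (\<lambda>(i, j, t). (i, j, 2 * t + j mod 2))"
  have "bij_betw pack A (carrier T)"
    unfolding bij_betw_def
  proof
    show "inj_on pack A"
      by (auto simp: inj_on_def pack_def)
    show "pack ` A = carrier T"
    proof
      have "2 * t + j mod 2 < 2 * 2 ^ l" "even (j + (2 * t + j mod 2))" if "t < 2 ^ l" for t j :: int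
        using that by (linarith, presburger)
      then show "pack ` A \<subseteq> carrier T"
        by (auto simp: A_def pack_def twisted_group_def)
      show "carrier T \<subseteq> pack ` A"
      proof
        fix g assume "g \<in> carrier T"
        then obtain i j r where g: "g = (i, j, r)" "i \<in> {0..<2 ^ n}" "j \<in> {0..<2 ^ m}"
          "0 \<le> r" "r < 2 * 2 ^ l" "even (j + r)"
          by (auto simp: twisted_group_def)
        have "2 * (r div 2) + j mod 2 = r"
          using \<open>even (j + r)\<close> by presburger
        moreover have "r div 2 < 2 ^ l" "0 \<le> r div 2"
          using g by linarith+
        ultimately have "g = pack (i, j, r div 2)" "(i, j, r div 2) \<in> A"
          using g by (simp_all add: pack_def A_def)
        then show "g \<in> pack ` A" by blast
      qed
    qed
  qed
  then have "order T = card A"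
    unfolding order_def by (simp add: bij_betw_same_card)
  then show ?thesis
    by (simp add: A_def card_cartesian_product power_add nat_power_eq)
qed

lemma finite_T: "finite (carrier T)"
  using order_T by (simp add: T.order_gt_0_iff_finite[symmetric])

definition D where "D = range (\<lambda>t. red 0 0 (2 * t))"

text \<open>A commutator is trivial in the first two coordinates, and even in the last because
  \<open>1 - sg i j\<close> is even. The commutator of \<open>(1, 0, 0)\<close> and
  \<open>(0, 1, 1)\<close> is \<open>(0, 0, -2)\<close> for every \<open>e\<close>, and it generates
  all even values.\<close>

lemma derived_T: "derived T (carrier T) = D"
proof
  have D_sub: "subgroup D T"
  proof
    show "D \<subseteq> carrier T"
      by (auto simp: D_def)
    show "g \<otimes>\<^bsub>T\<^esub> h \<in> D" if gh: "g \<in> D" "h \<in> D" for g h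
    proof -
      obtain t u where "g = red 0 0 (2 * t)" "h = red 0 0 (2 * u)"
        using gh by (auto simp: D_def)
      then have "g \<otimes>\<^bsub>T\<^esub> h = red 0 0 (2 * (t + u))"
        by (simp add: mult_red)
      then show ?thesis unfolding D_def by blast
    qed
    show "\<one>\<^bsub>T\<^esub> \<in> D"
      unfolding D_def one_T by (rule range_eqI[of _ _ 0]) simp
    show "inv\<^bsub>T\<^esub> g \<in> D" if g: "g \<in> D" for g
    proof -
      obtain t where "g = red 0 0 (2 * t)"
        using g by (auto simp: D_def)
      then have "inv\<^bsub>T\<^esub> g = red 0 0 (2 * (- t))"
        by (simp add: inv_red)
      then show ?thesis unfolding D_def by blast
    qed
  qed
  have "g \<otimes>\<^bsub>T\<^esub> h \<otimes>\<^bsub>T\<^esub> inv\<^bsub>T\<^esub> g \<otimes>\<^bsub>T\<^esub> inv\<^bsub>T\<^esub> h \<in> D" if "g \<in> carrier T" "h \<in> carrier T" for g h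
  proof -
    obtain i j r i' j' r' where g: "g = red i j r" "even (j + r)"
      and h: "h = red i' j' r'" "even (j' + r')"
      using \<open>g \<in> carrier T\<close> \<open>h \<in> carrier T\<close> by (elim carrierE)
    let ?s = "sg i j" and ?s' = "sg i' j'"
    have "g \<otimes>\<^bsub>T\<^esub> h \<otimes>\<^bsub>T\<^esub> inv\<^bsub>T\<^esub> g \<otimes>\<^bsub>T\<^esub> inv\<^bsub>T\<^esub> h = red 0 0 ((1 - ?s') * r - (1 - ?s) * r')"
      using g h by (simp add: inv_red mult_red parity_sign_add algebra_simps)
    moreover obtain t where "(1 - ?s') * r - (1 - ?s) * r' = 2 * t"
    proof -
      have "even ((1 - ?s') * r - (1 - ?s) * r')"
        by simp
      then show ?thesis using that by (elim evenE)
    qed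
    ultimately show ?thesis
      unfolding D_def by auto
  qed
  then show "derived T (carrier T) \<subseteq> D"
    unfolding derived_def by (intro T.generate_subgroup_incl[OF _ D_sub]) blast
  have gen: "red 0 0 (- 2) \<in> derived T (carrier T)"
    unfolding derived_def
  proof (rule generate.incl)
    have "red 0 0 (- 2) = red 1 0 0 \<otimes>\<^bsub>T\<^esub> red 0 1 1 \<otimes>\<^bsub>T\<^esub> inv\<^bsub>T\<^esub> (red 1 0 0) \<otimes>\<^bsub>T\<^esub> inv\<^bsub>T\<^esub> (red 0 1 1)"
      by (simp add: inv_red mult_red)
    then show "red 0 0 (- 2) \<in> (\<Union>h1\<in>carrier T. \<Union>h2\<in>carrier T.
        {h1 \<otimes>\<^bsub>T\<^esub> h2 \<otimes>\<^bsub>T\<^esub> inv\<^bsub>T\<^esub> h1 \<otimes>\<^bsub>T\<^esub> inv\<^bsub>T\<^esub> h2})"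
      by (intro UN_I[of "red 1 0 0"] UN_I[of "red 0 1 1"]) auto
  qed
  have "red 0 0 (2 * t) \<in> derived T (carrier T)" for t
    using T.subgroup_int_pow_closed[OF T.derived_is_subgroup[OF subset_refl] gen, of "- t"]
    by (simp add: int_pow_red mult.commute)
  then show "D \<subseteq> derived T (carrier T)"
    by (auto simp: D_def)
qed

lemma cyclic_commutator_subgroup_T: "cyclic_group (commutator_subgroup T)"
proof -
  have sub: "subgroup D T"
    using T.derived_is_subgroup[OF subset_refl] by (simp add: derived_T)
  interpret D: group "T\<lparr>carrier := D\<rparr>"
    using T.subgroup_imp_group[OF sub] .
  have mem: "red 0 0 2 \<in> D"
    unfolding D_def by (rule range_eqI[of _ _ 1]) simp
  have "red 0 0 2 [^]\<^bsub>T\<lparr>carrier := D\<rparr>\<^esub> (t::int) = red 0 0 (2 * t)" for t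
    using T.int_pow_consistent[OF sub mem, of t] by (simp add: int_pow_red mult.commute)
  then have "carrier (T\<lparr>carrier := D\<rparr>) = range (\<lambda>t::int. red 0 0 2 [^]\<^bsub>T\<lparr>carrier := D\<rparr>\<^esub> t)"
    by (simp add: D_def)
  then show ?thesis
    unfolding commutator_subgroup_def derived_T D.cyclic_group using mem by auto
qed

lemma order_commutator_subgroup_T: "order (commutator_subgroup T) = 2 ^ l"
proof -
  have "bij_betw (\<lambda>t. red 0 0 (2 * t)) {0..<2 ^ l :: int} D"
    unfolding bij_betw_def
  proof
    show "inj_on (\<lambda>t. red 0 0 (2 * t)) {0..<2 ^ l :: int}"
      by (auto simp: inj_on_def reduce_def mod_mult_mult1)
    show "(\<lambda>t. red 0 0 (2 * t)) ` {0..<2 ^ l :: int} = D"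
    proof
      show "D \<subseteq> (\<lambda>t. red 0 0 (2 * t)) ` {0..<2 ^ l :: int}"
      proof
        fix g assume "g \<in> D"
        then obtain t where "g = red 0 0 (2 * t)" by (auto simp: D_def)
        then have "g = red 0 0 (2 * (t mod 2 ^ l))"
          by (simp add: reduce_def mod_mult_mult1)
        then show "g \<in> (\<lambda>t. red 0 0 (2 * t)) ` {0..<2 ^ l :: int}" by auto
      qed
    qed (auto simp: D_def)
  qed
  then show ?thesis
    using bij_betw_same_card[of _ "{0..<2 ^ l :: int}" D] by (simp add: order_def commutator_subgroup_def derived_T nat_power_eq)
qed

end

section \<open>Homomorphisms out of the twisted group with \<open>e = 1\<close>\<close>

text \<open>A triple is sent to a normal form in \<open>w = y x\<close>, \<open>x\<close> and
  \<open>z = y y\<close>. Conjugation by \<open>x\<close> inverts \<open>w\<close> up to the central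
  factor \<open>c z\<close> with \<open>c = x x\<close>; hence normal forms multiply by the rule of
  the twisted group, and the relations make the map periodic in each coordinate.\<close>

lemma (in group) hom_from_twisted_group:
  assumes pos: "0 < n" "0 < m" and xy: "central_square_pair G l x y"
    and x_pow: "x [^] ((2::nat) ^ n) = \<one>" and y_pow: "y [^] ((2::nat) ^ m) = \<one>"
  shows "\<exists>\<theta>\<in>hom (twisted_group n m l 1) G.
    \<theta> (reduce n m l 1 0 0) = x \<and> \<theta> (reduce n m l 0 1 1) = y"
proof -
  interpret tw: twisted n m l 1
    using pos by unfold_locales
  define c where "c = x \<otimes> x"
  define z where "z = y \<otimes> y"
  define w where "w = y \<otimes> x"
  define v where "v = x \<otimes> y"
  have [simp]: "x \<in> carrier G" "y \<in> carrier G"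
    using xy by (auto simp: central_square_pair_def)
  then have [simp]: "c \<in> carrier G" "z \<in> carrier G" "w \<in> carrier G" "v \<in> carrier G"
    by (auto simp: c_def z_def w_def v_def)
  have cy: "c \<otimes> y = y \<otimes> c" and zx: "z \<otimes> x = x \<otimes> z"
    and vw_pow: "v [^] ((2::nat) ^ l) = w [^] ((2::nat) ^ l)"
    using xy by (auto simp: central_square_pair_def c_def z_def v_def w_def)
  have cx: "c \<otimes> x = x \<otimes> c" and zy: "z \<otimes> y = y \<otimes> z"
    by (simp_all add: c_def z_def m_assoc)
  have cw: "c \<otimes> w = w \<otimes> c" and zw: "z \<otimes> w = w \<otimes> z" and cz: "c \<otimes> z = z \<otimes> c"
    using cx cy zx zy by (auto simp: w_def z_def intro: commutes_mult)
  have wv: "w \<otimes> v = c \<otimes> z" and vw: "v \<otimes> w = c \<otimes> z"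
    using opposite_products_commute[of x y] cy zx by (auto simp: w_def v_def c_def z_def)
  have commute_pows: "a [^] (i::int) \<otimes> b [^] (j::int) = b [^] j \<otimes> a [^] i"
    if "a \<otimes> b = b \<otimes> a" "a \<in> carrier G" "b \<in> carrier G" for a b i j
    using that by (intro int_pow_intertwine int_pow_intertwine[symmetric]) auto
  have x_even: "x [^] (2 * i) = c [^] i" for i :: int
    using int_pow_pow[of x 2 i] int_pow_int[of G x 2] by (simp add: c_def numeral_2_eq_2)
  have z_pow: "z [^] (i::int) = y [^] (2 * i)" for i :: int
    using int_pow_pow[of y 2 i] int_pow_int[of G y 2] by (simp add: z_def numeral_2_eq_2)
  \<comment> \<open>From \<open>w v = c z\<close>, with \<open>c\<close> and \<open>z\<close>
    commuting with \<open>w\<close>, the element \<open>v\<close> is the inverse of \<open>w\<close>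
    times \<open>c z\<close>.\<close>
  have v_pow: "v [^] i = w [^] (- i) \<otimes> (c [^] i \<otimes> z [^] i)" for i :: int
  proof -
    have "v = inv w \<otimes> (c \<otimes> z)"
      by (simp add: wv[symmetric] m_assoc[symmetric])
    moreover have "inv w \<otimes> (c \<otimes> z) = c \<otimes> z \<otimes> inv w"
      using commutes_mult[of w c z] cw zw by (intro inv_intertwine[symmetric]) auto
    ultimately have "v [^] i = inv w [^] i \<otimes> (c \<otimes> z) [^] i"
      using int_pow_mult_distrib[of "inv w" "c \<otimes> z" i] by simp
    then show ?thesis
      using int_pow_mult_distrib[of c z i] cz by (simp add: int_pow_inv int_pow_neg)
  qed
  have x_w: "x \<otimes> w [^] i = v [^] i \<otimes> x" for i :: int
    by (rule int_pow_intertwine) (simp_all add: w_def v_def m_assoc)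
  have xw_even: "x [^] p \<otimes> w [^] r = w [^] r \<otimes> x [^] p" if "even p" for p r :: int
    using that commute_pows[OF cw, of _ r] by (auto elim!: evenE simp: x_even)
  \<comment> \<open>For \<open>p = 2 h + 1\<close> the power of \<open>c\<close> passes freely, and
    the one remaining \<open>x\<close> turns the power of \<open>w\<close> into a power of
    \<open>v\<close>.\<close>
  have xw_odd: "x [^] p \<otimes> w [^] r = w [^] (- r) \<otimes> (x [^] (p + 2 * r) \<otimes> z [^] r)"
    if "odd p" for p r :: int
  proof -
    obtain h where p: "p = 2 * h + 1"
      using \<open>odd p\<close> by (elim oddE)
    have "x [^] p \<otimes> w [^] r = c [^] h \<otimes> (x \<otimes> w [^] r)"
      by (simp add: p int_pow_mult x_even m_assoc)
    also have "\<dots> = c [^] h \<otimes> w [^] (- r) \<otimes> (c [^] r \<otimes> (z [^] r \<otimes> x))"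
      by (simp add: x_w v_pow m_assoc)
    also have "\<dots> = w [^] (- r) \<otimes> (c [^] h \<otimes> c [^] r) \<otimes> (x \<otimes> z [^] r)"
      using commute_pows[OF cw, of h "- r"] commute_pows[OF zx, of r 1] by (simp add: m_assoc)
    also have "\<dots> = w [^] (- r) \<otimes> (x [^] (2 * (h + r)) \<otimes> x) \<otimes> z [^] r"
      by (simp only: x_even int_pow_mult \<open>c \<in> carrier G\<close>) (simp add: m_assoc)
    also have "x [^] (2 * (h + r)) \<otimes> x = x [^] (p + 2 * r)"
      using int_pow_mult[of x "2 * (h + r)" 1] by (simp add: p algebra_simps)
    finally show ?thesis
      by (simp add: m_assoc)
  qed
  \<comment> \<open>In the twisted group, \<open>(i, j, r)\<close> equals \<open>w\<^sup>r\<close> times \<open>x\<close> to the power \<open>i - r\<close> times \<open>z\<close> to the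
    power \<open>(j - r) / 2\<close>, for \<open>x = (1, 0, 0)\<close> and \<open>y = (0, 1, 1)\<close>.\<close>
  define M where "M = (\<lambda>(r::int) (p::int) (q::int). w [^] r \<otimes> (x [^] p \<otimes> z [^] q))"
  have M_closed [simp]: "M r p q \<in> carrier G" for r p q
    by (simp add: M_def)
  have z_w: "z [^] i \<otimes> w [^] j = w [^] j \<otimes> z [^] i" for i j :: int
    by (rule commute_pows[OF zw]) auto
  have z_x: "z [^] i \<otimes> x [^] j = x [^] j \<otimes> z [^] i" for i j :: int
    by (rule commute_pows[OF zx]) auto
  have M_split: "M r p q \<otimes> M r' p' q' = w [^] r \<otimes> (x [^] p \<otimes> w [^] r') \<otimes> (x [^] p' \<otimes> z [^] (q + q'))"
    for r p q r' p' q'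
  proof -
    have "M r p q \<otimes> M r' p' q' = w [^] r \<otimes> x [^] p \<otimes> (z [^] q \<otimes> w [^] r') \<otimes> (x [^] p' \<otimes> z [^] q')"
      by (simp add: M_def m_assoc)
    also have "\<dots> = w [^] r \<otimes> (x [^] p \<otimes> w [^] r') \<otimes> (z [^] q \<otimes> x [^] p') \<otimes> z [^] q'"
      by (simp add: z_w m_assoc)
    finally show ?thesis
      by (simp add: z_x m_assoc int_pow_mult)
  qed
  have M_even: "M r p q \<otimes> M r' p' q' = M (r + r') (p + p') (q + q')" if "even p" for r p q r' p' q'
    unfolding M_split xw_even[OF that] by (simp add: M_def int_pow_mult m_assoc)
  have M_odd: "M r p q \<otimes> M r' p' q' = M (r - r') (p + p' + 2 * r') (q + q' + r')"
    if "odd p" for r p q r' p' q'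
  proof -
    have "M r p q \<otimes> M r' p' q'
        = w [^] r \<otimes> w [^] (- r') \<otimes> (x [^] (p + 2 * r') \<otimes> (z [^] r' \<otimes> x [^] p') \<otimes> z [^] (q + q'))"
      unfolding M_split xw_odd[OF that] by (simp add: m_assoc)
    also have "\<dots> = (w [^] r \<otimes> w [^] (- r')) \<otimes> ((x [^] (p + 2 * r') \<otimes> x [^] p') \<otimes> (z [^] r' \<otimes> z [^] (q + q')))"
      unfolding z_x by (simp add: m_assoc)
    also have "\<dots> = w [^] (r + - r') \<otimes> (x [^] (p + 2 * r' + p') \<otimes> z [^] (r' + (q + q')))"
      by (simp only: int_pow_mult \<open>w \<in> carrier G\<close> \<open>x \<in> carrier G\<close> \<open>z \<in> carrier G\<close>)
    also have "\<dots> = M (r - r') (p + p' + 2 * r') (q + q' + r')"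
      unfolding M_def by (simp add: algebra_simps)
    finally show ?thesis .
  qed
  have x_period: "x [^] (2 ^ n * t) = \<one>" for t :: int
    using x_pow int_pow_pow[of x "2 ^ n" t] int_pow_int[of G x "2 ^ n"] by simp
  have z_period: "z [^] (2 ^ (m - 1) * t) = \<one>" for t :: int
  proof -
    have "2 * 2 ^ (m - 1) = (2::int) ^ m"
      using pos by (cases m) auto
    then show ?thesis
      using y_pow int_pow_pow[of y "2 ^ m" t] int_pow_int[of G y "2 ^ m"]
      by (simp add: z_pow mult.assoc[symmetric])
  qed
  \<comment> \<open>Here the relation between the powers of \<open>x y\<close> and
    \<open>y x\<close> enters: half of the factors \<open>w\<close> are replaced by
    \<open>v\<close>, and \<open>w v = c z\<close>.\<close>
  have w_period: "w [^] (2 ^ Suc l * t) = x [^] (2 ^ Suc l * t) \<otimes> z [^] (2 ^ l * t)" for t :: int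
  proof -
    have "w [^] ((2::nat) ^ Suc l) = w [^] ((2::nat) ^ l) \<otimes> v [^] ((2::nat) ^ l)"
      by (simp add: vw_pow nat_pow_mult mult_2)
    also have "\<dots> = (c \<otimes> z) [^] ((2::nat) ^ l)"
      using wv vw by (simp add: pow_mult_distrib[symmetric])
    finally have "w [^] ((2::int) ^ Suc l) = (c \<otimes> z) [^] ((2::int) ^ l)"
      using int_pow_int[of G w "2 ^ Suc l"] int_pow_int[of G "c \<otimes> z" "2 ^ l"] by simp
    then have "w [^] (2 ^ Suc l * t) = (c \<otimes> z) [^] (2 ^ l * t)"
      by (metis \<open>w \<in> carrier G\<close> \<open>c \<in> carrier G\<close> \<open>z \<in> carrier G\<close> int_pow_pow m_closed)
    then show ?thesis
      using x_even[of "2 ^ l * t"] int_pow_mult_distrib[OF cz, of "2 ^ l * t"]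
      by (simp add: mult.assoc)
  qed
  define F where "F = (\<lambda>i j r. M r (i - r) ((j - r) div 2))"
  have F_period_i: "F (i + 2 ^ n * t) j r = F i j r" for i j r t
    using int_pow_mult[of x "i - r" "2 ^ n * t"] x_period[of t] by (simp add: F_def M_def algebra_simps)
  have F_period_j: "F i (j + 2 ^ m * t) r = F i j r" for i j r t
  proof -
    have "2 * 2 ^ (m - 1) = (2::int) ^ m"
      using pos by (cases m) auto
    then have "j + 2 ^ m * t - r = (j - r) + 2 * (2 ^ (m - 1) * t)"
      by (simp add: mult.assoc[symmetric])
    then have "(j + 2 ^ m * t - r) div 2 = ((j - r) + 2 * (2 ^ (m - 1) * t)) div 2"
      by (simp only:)
    then have "(j + 2 ^ m * t - r) div 2 = (j - r) div 2 + 2 ^ (m - 1) * t"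
      by linarith
    then show ?thesis
      using z_period[of t] by (simp add: F_def M_def int_pow_mult)
  qed
  \<comment> \<open>The shift of \<open>r\<close> also lowers the exponents of \<open>x\<close> and
    \<open>z\<close>; by \<open>w_period\<close> the three changes cancel.\<close>
  have F_period_r: "F i j (r + 2 ^ Suc l * t) = F i j r" for i j r t
  proof -
    let ?k = "2 ^ Suc l * t" and ?h = "2 ^ l * t"
    have q: "(j - (r + ?k)) div 2 = (j - r) div 2 - ?h"
    proof -
      have "j - (r + ?k) = (j - r) + 2 * (- ?h)" by simp
      then show ?thesis by linarith
    qed
    have "F i j (r + ?k) = w [^] r \<otimes> (w [^] ?k \<otimes> (x [^] (i - (r + ?k)) \<otimes> z [^] ((j - r) div 2 - ?h)))"
      unfolding F_def M_def q by (simp add: int_pow_mult m_assoc)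
    also have "w [^] ?k \<otimes> (x [^] (i - (r + ?k)) \<otimes> z [^] ((j - r) div 2 - ?h))
        = x [^] ?k \<otimes> (z [^] ?h \<otimes> x [^] (i - (r + ?k))) \<otimes> z [^] ((j - r) div 2 - ?h)"
      unfolding w_period by (simp add: m_assoc)
    also have "\<dots> = (x [^] ?k \<otimes> x [^] (i - (r + ?k))) \<otimes> (z [^] ?h \<otimes> z [^] ((j - r) div 2 - ?h))"
      unfolding z_x by (simp add: m_assoc)
    also have "\<dots> = x [^] (i - r) \<otimes> z [^] ((j - r) div 2)"
      by (simp add: int_pow_mult[symmetric] del: power_Suc)
    finally show ?thesis
      by (simp add: F_def M_def)
  qed
  have F_mod: "F (i mod 2 ^ n) (j mod 2 ^ m) (r mod 2 ^ Suc l) = F i j r" for i j r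
    using F_period_i[of "i mod 2 ^ n" "i div 2 ^ n"] F_period_j[of _ "j mod 2 ^ m" "j div 2 ^ m"]
      F_period_r[of _ _ "r mod 2 ^ Suc l" "r div 2 ^ Suc l"]
    by (simp only: mod_mult_div_eq)
  define \<theta> where "\<theta> = (\<lambda>(i, j, r). F i j r)"
  have \<theta>_red: "\<theta> (reduce n m l i j r) = F i j r" for i j r
    by (simp only: \<theta>_def reduce_def case_prod_conv F_mod)
  have "\<theta> \<in> hom (twisted_group n m l 1) G"
  proof (rule homI)
    fix g assume "g \<in> carrier (twisted_group n m l 1)"
    then show "\<theta> g \<in> carrier G"
      by (elim tw.carrierE) (simp add: \<theta>_red F_def)
  next
    fix g h assume "g \<in> carrier (twisted_group n m l 1)" "h \<in> carrier (twisted_group n m l 1)"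
    then obtain i j r i' j' r' where g: "g = tw.red i j r" "even (j + r)"
      and h: "h = tw.red i' j' r'" "even (j' + r')"
      by (elim tw.carrierE)
    obtain q q' where q: "j = r + 2 * q" "j' = r' + 2 * q'"
    proof -
      have "j = r + 2 * ((j - r) div 2)" "j' = r' + 2 * ((j' - r') div 2)"
        using g(2) h(2) by presburger+
      then show ?thesis by (rule that)
    qed
    \<comment> \<open>As \<open>j\<close> and \<open>r\<close> have equal parity, the exponent
      \<open>i - r\<close> of \<open>x\<close> is odd exactly when the sign for \<open>i\<close> and
      \<open>j\<close> is \<open>-1\<close>.\<close>
    have "F i j r \<otimes> F i' j' r' = F (i + i') (j + j') (r + parity_sign (i + 1 * j) * r')"
    proof (cases "even (i + j)")
      case True
      then have "even (i - r)"
        using g(2) by presburger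
      moreover have "(j + j' - (r + r')) div 2 = q + q'"
        by (simp add: q)
      ultimately show ?thesis
        using True by (simp add: F_def M_even parity_sign_def q algebra_simps)
    next
      case False
      then have "odd (i - r)"
        using g(2) by presburger
      moreover have "(j + j' - (r - r')) div 2 = q + q' + r'"
        by (simp add: q)
      ultimately show ?thesis
        using False by (simp add: F_def M_odd parity_sign_def q algebra_simps)
    qed
    then show "\<theta> (g \<otimes>\<^bsub>twisted_group n m l 1\<^esub> h) = \<theta> g \<otimes> \<theta> h"
      unfolding g h tw.mult_red \<theta>_red by simp
  qed
  moreover have "\<theta> (reduce n m l 1 0 0) = x"
    by (simp add: \<theta>_red F_def M_def)
  moreover have "\<theta> (reduce n m l 0 1 1) = y"
    by (simp add: \<theta>_red F_def M_def w_def int_pow_neg m_assoc)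
  ultimately show ?thesis by blast
qed

lemma (in group_hom) central_square_pair_hom:
  assumes "central_square_pair G l x y"
  shows "central_square_pair H l (h x) (h y)"
proof -
  have xy: "x \<in> carrier G" "y \<in> carrier G"
    using assms by (auto simp: central_square_pair_def)
  have "h (x \<otimes> x \<otimes> y) = h (y \<otimes> (x \<otimes> x))" "h (y \<otimes> y \<otimes> x) = h (x \<otimes> (y \<otimes> y))"
    "h ((x \<otimes> y) [^] ((2::nat) ^ l)) = h ((y \<otimes> x) [^] ((2::nat) ^ l))"
    using assms by (simp_all add: central_square_pair_def)
  then show ?thesis
    using xy by (simp add: central_square_pair_def hom_nat_pow)
qed

section \<open>Generators and relations of the twisted group with \<open>e = 0\<close>\<close>

locale twisted_0 = twisted n m l 0 for n m l
begin

text \<open>The second generator has first coordinate 1, so both generators act by the sign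
  \<open>-1\<close>. Their products are \<open>(2, 1, -1)\<close> and \<open>(2, 1, 1)\<close>; the
  last coordinates of the powers differ by \<open>2 * 2 ^ l\<close>, which is the modulus.\<close>

lemma central_square_pair_generators: "central_square_pair T l (red 1 0 0) (red 1 1 1)"
proof -
  have "(red 1 0 0 \<otimes>\<^bsub>T\<^esub> red 1 1 1) [^]\<^bsub>T\<^esub> ((2::nat) ^ l) = (red 1 1 1 \<otimes>\<^bsub>T\<^esub> red 1 0 0) [^]\<^bsub>T\<^esub> ((2::nat) ^ l)"
    by (simp add: mult_red nat_pow_red red_eq_iff)
  then show ?thesis
    unfolding central_square_pair_def by (simp add: mult_red parity_sign_def)
qed

lemma generators_pow:
  shows "red 1 0 0 [^]\<^bsub>T\<^esub> ((2::nat) ^ n) = \<one>\<^bsub>T\<^esub>"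
    and "red 1 1 1 [^]\<^bsub>T\<^esub> ((2::nat) ^ m) = red 1 0 0 [^]\<^bsub>T\<^esub> ((2::nat) ^ m)"
proof -
  show "red 1 0 0 [^]\<^bsub>T\<^esub> ((2::nat) ^ n) = \<one>\<^bsub>T\<^esub>"
    by (simp add: nat_pow_red one_T red_eq_iff)
  \<comment> \<open>\<open>nat_pow_red\<close> does not cover \<open>(1, 1, 1)\<close>, which acts
    by \<open>-1\<close> and has nonzero last coordinate, but it covers the square
    \<open>(2, 2, 0)\<close>.\<close>
  have "(2::int) ^ m = 2 * 2 ^ (m - 1)" "Suc (m - 1) = m"
    using m_pos by (cases m; simp)+
  moreover from this have "red 1 1 1 [^]\<^bsub>T\<^esub> ((2::nat) ^ m) = red 2 2 0 [^]\<^bsub>T\<^esub> ((2::nat) ^ (m - 1))"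
    using T.nat_pow_two_power_Suc[of "red 1 1 1" "m - 1"] by (simp add: mult_red del: power_Suc)
  ultimately show "red 1 1 1 [^]\<^bsub>T\<^esub> ((2::nat) ^ m) = red 1 0 0 [^]\<^bsub>T\<^esub> ((2::nat) ^ m)"
    by (simp add: nat_pow_red red_eq_iff)
qed

lemma generate_generators: "generate T {red 1 0 0, red 1 1 1} = carrier T"
proof
  let ?S = "{red 1 0 0, red 1 1 1}"
  have sub: "subgroup (generate T ?S) T"
    by (rule T.generate_is_subgroup) auto
  show "generate T ?S \<subseteq> carrier T"
    using subgroup.subset[OF sub] .
  show "carrier T \<subseteq> generate T ?S"
  proof
    fix g assume "g \<in> carrier T"
    then obtain i j r where g: "g = red i j r" "even (j + r)"
      by (elim carrierE)
    then obtain q where q: "j = r + 2 * q"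
      by (metis even_add dvd_diff_commute evenE even_diff add.commute diff_add_cancel)
    let ?x = "red 1 0 0" and ?y = "red 1 1 1"
    \<comment> \<open>With \<open>y x = (2, 1, 1)\<close> and \<open>y y = (2, 2, 0)\<close> the
      first two powers produce the coordinates \<open>r + 2 * q\<close> and \<open>r\<close>; the
      exponent of \<open>x\<close> then corrects the first coordinate.\<close>
    have "(?y \<otimes>\<^bsub>T\<^esub> ?x) [^]\<^bsub>T\<^esub> r \<otimes>\<^bsub>T\<^esub> ((?y \<otimes>\<^bsub>T\<^esub> ?y) [^]\<^bsub>T\<^esub> q \<otimes>\<^bsub>T\<^esub> ?x [^]\<^bsub>T\<^esub> (i - 2 * r - 2 * q))
        = red i j r"
      by (simp add: mult_red int_pow_red q algebra_simps)
    moreover have "?x \<in> generate T ?S" "?y \<in> generate T ?S"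
      by (auto intro: generate.incl)
    then have "(?y \<otimes>\<^bsub>T\<^esub> ?x) [^]\<^bsub>T\<^esub> r \<otimes>\<^bsub>T\<^esub> ((?y \<otimes>\<^bsub>T\<^esub> ?y) [^]\<^bsub>T\<^esub> q \<otimes>\<^bsub>T\<^esub> ?x [^]\<^bsub>T\<^esub> (i - 2 * r - 2 * q))
        \<in> generate T ?S"
      by (intro subgroup.m_closed[OF sub] T.subgroup_int_pow_closed[OF sub])
    ultimately show "g \<in> generate T ?S"
      using g by simp
  qed
qed

end

section \<open>A property that separates the two groups\<close>

text \<open>Here \<open>c\<close> is the commutator of \<open>g\<close> and \<open>h\<close>. In a
  twisted group the commutator subgroup is cyclic of order \<open>2 ^ l\<close>, so for positive
  \<open>l\<close> the last condition says that \<open>c\<close> generates it. Being built from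
  equations and one inequation, the property is carried along by isomorphisms.\<close>

definition central_commutator_witness :: "('g, 'x) monoid_scheme \<Rightarrow> nat \<Rightarrow> nat \<Rightarrow> 'g \<Rightarrow> 'g \<Rightarrow> 'g \<Rightarrow> bool" where
  "central_commutator_witness G m l g h c \<longleftrightarrow> g \<in> carrier G \<and> h \<in> carrier G \<and> c \<in> carrier G \<and>
     g [^]\<^bsub>G\<^esub> ((2::nat) ^ m) = \<one>\<^bsub>G\<^esub> \<and> g \<otimes>\<^bsub>G\<^esub> h = c \<otimes>\<^bsub>G\<^esub> (h \<otimes>\<^bsub>G\<^esub> g) \<and> g \<otimes>\<^bsub>G\<^esub> c = c \<otimes>\<^bsub>G\<^esub> g \<and>
     c [^]\<^bsub>G\<^esub> ((2::nat) ^ (l - 1)) \<noteq> \<one>\<^bsub>G\<^esub>"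

lemma central_commutator_witness_iso:
  assumes "group G" "group H" "f \<in> iso G H" "central_commutator_witness G m l g h c"
  shows "central_commutator_witness H m l (f g) (f h) (f c)"
proof -
  interpret group_hom G H f
    using assms by (simp add: group_hom_def group_hom_axioms_def iso_def)
  have inj: "inj_on f (carrier G)"
    using assms(3) by (simp add: iso_def bij_betw_def)
  have ghc: "g \<in> carrier G" "h \<in> carrier G" "c \<in> carrier G"
    and ne: "c [^]\<^bsub>G\<^esub> ((2::nat) ^ (l - 1)) \<noteq> \<one>\<^bsub>G\<^esub>"
    using assms(4) by (auto simp: central_commutator_witness_def)
  have "f (g \<otimes>\<^bsub>G\<^esub> h) = f (c \<otimes>\<^bsub>G\<^esub> (h \<otimes>\<^bsub>G\<^esub> g))" "f (g \<otimes>\<^bsub>G\<^esub> c) = f (c \<otimes>\<^bsub>G\<^esub> g)"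
    "f (g [^]\<^bsub>G\<^esub> ((2::nat) ^ m)) = f \<one>\<^bsub>G\<^esub>"
    using assms(4) by (simp_all add: central_commutator_witness_def)
  moreover have "f (c [^]\<^bsub>G\<^esub> ((2::nat) ^ (l - 1))) \<noteq> f \<one>\<^bsub>G\<^esub>"
    using inj_onD[OF inj, of "c [^]\<^bsub>G\<^esub> ((2::nat) ^ (l - 1))" "\<one>\<^bsub>G\<^esub>"] ne ghc by auto
  ultimately show ?thesis
    using ghc by (simp add: central_commutator_witness_def hom_nat_pow)
qed

text \<open>For \<open>e = 0\<close> the element \<open>(0, 1, 1)\<close> acts trivially on the last
  coordinate, and \<open>l < m\<close> makes \<open>2 ^ m\<close> a multiple of its order. Only
  \<open>(1, 0, 0)\<close> inverts, which produces the commutator \<open>(0, 0, 2)\<close>.\<close>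

lemma twisted_group_0_central_commutator_witness:
  assumes "l < m" "m < n" "2 \<le> l"
  shows "central_commutator_witness (twisted_group n m l 0) m l
    (reduce n m l 0 1 1) (reduce n m l 1 0 0) (reduce n m l 0 0 2)"
proof -
  interpret twisted n m l 0
    using assms by unfold_locales auto
  have "(2::int) ^ l = 2 * 2 ^ (l - 1)"
    using assms by (cases l) auto
  moreover have "\<not> (2::int) ^ Suc l dvd 2 ^ l" "(2::int) ^ Suc l dvd 2 ^ m"
    using assms le_imp_power_dvd[of "Suc l" m "2::int"] by (auto dest!: zdvd_imp_le)
  ultimately show ?thesis
    by (simp add: central_commutator_witness_def mult_red nat_pow_red one_T red_eq_iff mult.commute)
qed

lemma twisted_group_1_no_central_commutator_witness:
  assumes "l < m" "m < n" "2 \<le> l"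
  shows "\<not> central_commutator_witness (twisted_group n m l 1) m l g h c"
proof
  interpret twisted n m l 1
    using assms by unfold_locales auto
  assume odd: "central_commutator_witness T m l g h c"
  then obtain i j r i' j' r' i'' j'' t where g: "g = red i j r" "even (j + r)"
    and h: "h = red i' j' r'" and c: "c = red i'' j'' t"
    and "0 \<le> i''" "i'' < 2 ^ n" "0 \<le> j''" "j'' < 2 ^ m"
    unfolding central_commutator_witness_def by (metis carrierE)
  have pow: "g [^]\<^bsub>T\<^esub> ((2::nat) ^ m) = \<one>\<^bsub>T\<^esub>" and comm: "g \<otimes>\<^bsub>T\<^esub> h = c \<otimes>\<^bsub>T\<^esub> (h \<otimes>\<^bsub>T\<^esub> g)"
    and gc: "g \<otimes>\<^bsub>T\<^esub> c = c \<otimes>\<^bsub>T\<^esub> g" and c_pow: "c [^]\<^bsub>T\<^esub> ((2::nat) ^ (l - 1)) \<noteq> \<one>\<^bsub>T\<^esub>"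
    using odd by (auto simp: central_commutator_witness_def)
  let ?N = "2 ^ Suc l :: int"
  \<comment> \<open>The first two coordinates add up without a twist, so they vanish in a
    commutator.\<close>
  have "2 ^ n dvd - i''" "2 ^ m dvd - j''"
    using comm by (simp_all add: g h c mult_red red_eq_iff algebra_simps)
  then have [simp]: "i'' = 0" "j'' = 0"
    using \<open>0 \<le> i''\<close> \<open>i'' < 2 ^ n\<close> \<open>0 \<le> j''\<close> \<open>j'' < 2 ^ m\<close> by (auto dest!: zdvd_imp_le)
  have t: "?N dvd (r + sg i j * r') - (t + (r' + sg i' j' * r))"
    using comm by (simp add: g h c mult_red red_eq_iff)
  have "\<not> ?N dvd 2 ^ (l - 1) * t"
    using c_pow by (simp add: c nat_pow_red one_T red_eq_iff)
  moreover have N: "?N = 2 ^ (l - 1) * 4"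
    using assms by (cases l) auto
  \<comment> \<open>Cancelling \<open>2 ^ (l - 1)\<close> leaves the modulus 4. The unwanted
    parities of \<open>i\<close> and \<open>j\<close> are excluded below by deriving
    \<open>4 dvd t\<close>.\<close>
  ultimately have t4: "\<not> 4 dvd t"
    by simp
  \<comment> \<open>Otherwise \<open>g\<close> inverts \<open>c\<close> and also commutes with it,
    so \<open>2 * t\<close> vanishes modulo \<open>2 ^ Suc l\<close>; as \<open>2 \<le> l\<close>,
    this makes \<open>t\<close> divisible by 4.\<close>
  have even_ij: "even (i + j)"
  proof (rule ccontr)
    assume "odd (i + j)"
    then have "?N dvd (r - t) - (t + r)"
      using gc by (simp add: g c mult_red red_eq_iff parity_sign_def)
    then have "?N dvd 2 * t"
      by (simp add: algebra_simps)
    then have "2 ^ l dvd t"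
      by simp
    moreover have "(4::int) dvd 2 ^ l"
      using le_imp_power_dvd[of 2 l "2::int"] assms by simp
    ultimately show False
      using t4 dvd_trans by blast
  qed
  \<comment> \<open>For even \<open>j\<close> also \<open>r\<close> is even. Since \<open>g\<close>
    acts trivially, \<open>t\<close> is congruent modulo 4 to \<open>(1 - sg i' j') * r\<close>, a
    product of two even numbers.\<close>
  have "odd j"
  proof
    assume "even j"
    then have "even r" using g by simp
    have "4 dvd ?N"
      using N by simp
    then have "4 dvd (r + sg i j * r') - (t + (r' + sg i' j' * r))"
      using t dvd_trans by blast
    moreover have "(r + sg i j * r') - (t + (r' + sg i' j' * r)) = (1 - sg i' j') * r - t"
      using even_ij by (simp add: parity_sign_def algebra_simps)
    moreover have "4 dvd (1 - sg i' j') * r"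
      using \<open>even r\<close> by (auto simp: parity_sign_def elim!: evenE)
    ultimately show False
      using t4 by (metis dvd_diffD1 dvd_diff_right_iff)
  qed
  then have "odd i"
    using even_ij by simp
  \<comment> \<open>The first coordinate of the power is \<open>2 ^ m * i\<close>; since
    \<open>m < n\<close>, it can vanish modulo \<open>2 ^ n\<close> only for even
    \<open>i\<close>.\<close>
  have "2 ^ n dvd 2 ^ m * i"
    using pow even_ij by (simp add: g nat_pow_red one_T red_eq_iff)
  moreover have "(2::int) ^ n = 2 ^ m * 2 ^ (n - m)"
    using assms by (simp flip: power_add)
  ultimately have "2 ^ (n - m) dvd i"
    by simp
  then show False
    using \<open>odd i\<close> assms dvd_trans[of 2 "2 ^ (n - m)" i] by auto
qed

section \<open>Transport along group isomorphisms\<close>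

lemma iso_commutator_subgroup:
  assumes "group G" "group H" "f \<in> iso G H"
  shows "f \<in> iso (commutator_subgroup G) (commutator_subgroup H)"
proof -
  interpret group_hom G H f
    using assms by (simp add: group_hom_def group_hom_axioms_def iso_def)
  have "f ` derived G (carrier G) = derived H (carrier H)"
    using derived_img[OF subset_refl] assms(3) by (simp add: iso_def bij_betw_def)
  moreover have sub: "derived G (carrier G) \<subseteq> carrier G"
    by (rule G.derived_in_carrier) simp
  moreover have "inj_on f (derived G (carrier G))"
    using assms(3) sub by (auto simp: iso_def bij_betw_def intro: inj_on_subset)
  ultimately show ?thesis
    unfolding commutator_subgroup_def iso_def hom_def bij_betw_def by (auto simp: subset_iff)
qed

text \<open>Twisted groups consist of triples, whereas the groups sought live on \<open>nat\<close>.
  A finite carrier injects into \<open>nat\<close>, and the group structure is transported along the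
  injection.\<close>

lemma iso_nat_monoid:
  assumes "group G" "finite (carrier G)"
  shows "\<exists>(H :: nat monoid) f. group H \<and> f \<in> iso G H"
proof -
  interpret group G by fact
  obtain f :: "'a \<Rightarrow> nat" where f: "inj_on f (carrier G)"
    using finite_imp_inj_to_nat_seg[OF assms(2)] by blast
  define H where "H = image_group f G"
  have "f \<in> iso G H"
    using f by (auto simp: H_def image_group_def iso_def hom_def bij_betw_def)
  moreover from this have "group (H\<lparr>one := f \<one>\<^bsub>G\<^esub>\<rparr>)"
    by (rule iso_imp_img_group)
  then have "group H"
    by (simp add: H_def image_group_def)
  ultimately show ?thesis by blast
qed

section \<open>The isomorphism of the group algebras\<close>

lemma nat_pow_units_of: "x [^]\<^bsub>units_of R\<^esub> (q::nat) = x [^]\<^bsub>R\<^esub> q"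
  by (simp add: nat_pow_def units_of_def)

text \<open>From left to right this moves the relations of group elements into the ring, where
  \<open>Y\<close> can be formed; from right to left it returns the relations of \<open>x\<close>
  and \<open>Y\<close> to a group.\<close>

lemma central_square_pair_units_of:
  "central_square_pair (units_of R) l x y \<longleftrightarrow>
     x \<in> Units R \<and> y \<in> Units R \<and> central_square_pair R l x y"
  by (auto simp: central_square_pair_def units_of_carrier units_of_mult nat_pow_units_of Units_def)

lemma (in monoid) Units_if_nat_pow_eq_one:
  assumes "x \<in> carrier G" "x [^] (q::nat) = \<one>" "0 < q"
  shows "x \<in> Units G"
proof -
  obtain p where "q = Suc p"
    using \<open>0 < q\<close> gr0_conv_Suc by blast
  then have "x [^] p \<otimes> x = \<one>" "x \<otimes> x [^] p = \<one>"
    using assms nat_pow_Suc2[of x p] by auto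
  then show ?thesis
    using assms(1) unfolding Units_def by blast
qed

text \<open>The isomorphisms point in opposite directions: \<open>\<eta>\<close> carries the
  generators and their relations into \<open>H\<close>, while \<open>\<gamma>\<close> is followed by
  the homomorphism from the twisted group into the units of the group algebra of
  \<open>H\<close>.\<close>

lemma algebras_isomorphic_twisted_groups:
  fixes K :: "('k, 'r) ring_scheme" and G :: "('g, 'x) monoid_scheme" and H :: "('h, 'y) monoid_scheme"
  assumes K: "cring K" "finite (carrier K)" "\<one>\<^bsub>K\<^esub> \<oplus>\<^bsub>K\<^esub> \<one>\<^bsub>K\<^esub> = \<zero>\<^bsub>K\<^esub>"
    and G: "group G" "\<gamma> \<in> iso G (twisted_group n m l 1)"
    and H: "group H" "\<eta> \<in> iso (twisted_group n m l 0) H"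
    and lmn: "l < m" "m < n"
  shows "algebras_isomorphic K (group_algebra K G) (group_algebra K H)"
proof -
  interpret t0: twisted_0 n m l
    using lmn by unfold_locales auto
  interpret t1: twisted n m l 1
    using lmn by unfold_locales auto
  have order_G: "order G = 2 ^ (n + m + l)"
    using iso_same_card[OF is_isoI[OF G(2)]] t1.order_T by (simp add: order_def)
  have order_H: "order H = 2 ^ (n + m + l)"
    using iso_same_card[OF is_isoI[OF H(2)]] t0.order_T by (simp add: order_def)
  interpret G: finite_group_algebra K G
    using K(1) G(1) order_G monoid.order_gt_0_iff_finite[OF group.is_monoid[OF G(1)]]
    by (simp add: finite_group_algebra_def finite_group_algebra_axioms_def)
  interpret H: finite_group_algebra K H
    using K(1) H(1) order_H monoid.order_gt_0_iff_finite[OF group.is_monoid[OF H(1)]]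
    by (simp add: finite_group_algebra_def finite_group_algebra_axioms_def)
  interpret KH: associative_algebra K H.KG
    by (rule H.associative_algebra_KG)
  let ?U = "units_of H.KG"
  interpret U: group ?U
    by (rule KH.units_group)
  interpret \<eta>: group_hom t0.T H \<eta>
    using H t0.group_T by (simp add: group_hom_def group_hom_axioms_def iso_def)
  interpret \<delta>: group_hom H ?U H.basis
    using H.basis_hom_units H(1) U.group_axioms by (simp add: group_hom_def group_hom_axioms_def)
  define a where "a = \<eta> (t0.red 1 0 0)"
  define b where "b = \<eta> (t0.red 1 1 1)"
  have ab [simp]: "a \<in> carrier H" "b \<in> carrier H"
    by (simp_all add: a_def b_def)
  define x where "x = H.basis a"
  define y where "y = H.basis b"
  have "central_square_pair ?U l x y"
    unfolding x_def y_def a_def b_def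
    by (intro \<delta>.central_square_pair_hom \<eta>.central_square_pair_hom t0.central_square_pair_generators)
  then have x_unit: "x \<in> Units H.KG" and pair: "central_square_pair H.KG l x y"
    by (auto simp: central_square_pair_units_of)
  have xy [simp]: "x \<in> carrier H.KG" "y \<in> carrier H.KG"
    by (simp_all add: x_def y_def)
  have x_pow: "x [^]\<^bsub>H.KG\<^esub> ((2::nat) ^ n) = \<one>\<^bsub>H.KG\<^esub>"
  proof -
    have "a [^]\<^bsub>H\<^esub> ((2::nat) ^ n) = \<one>\<^bsub>H\<^esub>"
      using t0.generators_pow(1) \<eta>.hom_nat_pow[of "t0.red 1 0 0" "2 ^ n"] by (simp add: a_def)
    then show ?thesis
      using \<delta>.hom_nat_pow[of a "2 ^ n"] by (simp add: x_def nat_pow_units_of H.one_KG)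
  qed
  have xy_pow: "y [^]\<^bsub>H.KG\<^esub> ((2::nat) ^ m) = x [^]\<^bsub>H.KG\<^esub> ((2::nat) ^ m)"
  proof -
    have "b [^]\<^bsub>H\<^esub> ((2::nat) ^ m) = a [^]\<^bsub>H\<^esub> ((2::nat) ^ m)"
      using t0.generators_pow(2) \<eta>.hom_nat_pow[of "t0.red 1 0 0" "2 ^ m"]
        \<eta>.hom_nat_pow[of "t0.red 1 1 1" "2 ^ m"] by (simp add: a_def b_def)
    then show ?thesis
      using \<delta>.hom_nat_pow[of a "2 ^ m"] \<delta>.hom_nat_pow[of b "2 ^ m"]
      by (simp add: x_def y_def nat_pow_units_of)
  qed
  have char2: "\<one>\<^bsub>H.KG\<^esub> \<oplus>\<^bsub>H.KG\<^esub> \<one>\<^bsub>H.KG\<^esub> = \<zero>\<^bsub>H.KG\<^esub>"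
  proof -
    have "\<one>\<^bsub>H.KG\<^esub> \<oplus>\<^bsub>H.KG\<^esub> \<one>\<^bsub>H.KG\<^esub> = (\<one>\<^bsub>K\<^esub> \<oplus>\<^bsub>K\<^esub> \<one>\<^bsub>K\<^esub>) \<odot>\<^bsub>H.KG\<^esub> \<one>\<^bsub>H.KG\<^esub>"
      by (simp add: KH.smult_l_distr del: H.basis_closed)
    then show ?thesis
      by (simp add: K(3))
  qed
  define Y where "Y = \<one>\<^bsub>H.KG\<^esub> \<oplus>\<^bsub>H.KG\<^esub> x \<oplus>\<^bsub>H.KG\<^esub> y"
  have Y [simp]: "Y \<in> carrier H.KG"
    by (simp add: Y_def)
  have Y_pair: "central_square_pair H.KG l x Y"
    unfolding Y_def by (rule KH.central_square_pair_shift[OF char2 pair \<open>l < m\<close>])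
  \<comment> \<open>Equal powers of \<open>x\<close> and \<open>y\<close> cancel in characteristic
    2. This converts the relation that holds for \<open>e = 0\<close> into the one required for
    \<open>e = 1\<close>.\<close>
  have Y_pow: "Y [^]\<^bsub>H.KG\<^esub> ((2::nat) ^ m) = \<one>\<^bsub>H.KG\<^esub>"
    unfolding Y_def KH.central_square_pair_shift(2)[OF char2 pair \<open>l < m\<close>] xy_pow
    by (simp add: KH.a_assoc KH.char2_double[OF char2])
  have Y_unit: "Y \<in> Units H.KG"
    using Y_pow by (intro KH.Units_if_nat_pow_eq_one[of _ "2 ^ m"]) auto
  obtain \<theta> where \<theta>: "\<theta> \<in> hom t1.T ?U" "\<theta> (t1.red 1 0 0) = x" "\<theta> (t1.red 0 1 1) = Y"
    using U.hom_from_twisted_group[OF t1.n_pos t1.m_pos, of l x Y]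
      x_unit Y_unit Y_pair x_pow Y_pow
    by (auto simp: central_square_pair_units_of nat_pow_units_of units_of_one)
  have \<theta>\<gamma>: "\<theta> \<circ> \<gamma> \<in> hom G ?U"
    using G(2) \<theta>(1) by (intro hom_compose[of _ _ t1.T]) (auto simp: iso_def)
  then have \<theta>\<gamma>_closed: "\<theta> \<circ> \<gamma> \<in> carrier G \<rightarrow> carrier H.KG"
    using KH.Units_closed by (auto simp: hom_def units_of_carrier Pi_iff)
  let ?\<phi> = "G.linear_extension H.KG (\<theta> \<circ> \<gamma>)"
  note \<phi>_basis = G.linear_extension_basis[OF H.associative_algebra_KG \<theta>\<gamma>_closed]
  note \<phi>_add = G.linear_extension_add[OF H.associative_algebra_KG \<theta>\<gamma>_closed]
  have "\<gamma> ` carrier G = carrier t1.T"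
    using G(2) by (simp add: iso_def bij_betw_def)
  then have "t1.red 1 0 0 \<in> \<gamma> ` carrier G" "t1.red 0 1 1 \<in> \<gamma> ` carrier G"
    by simp_all
  then obtain g1 g2 where g1: "g1 \<in> carrier G" "\<gamma> g1 = t1.red 1 0 0"
    and g2: "g2 \<in> carrier G" "\<gamma> g2 = t1.red 0 1 1"
    by (elim imageE) simp
  have "?\<phi> (G.basis g1) = x"
    using \<phi>_basis[OF g1(1)] g1(2) \<theta>(2) by simp
  then have x_img: "x \<in> ?\<phi> ` carrier G.KG"
    by (metis G.basis_closed imageI)
  \<comment> \<open>The change of generators is its own inverse in characteristic 2, so
    \<open>y = 1 + x + Y\<close>.\<close>
  have y_img: "y \<in> ?\<phi> ` carrier G.KG"
  proof
    have "?\<phi> \<one>\<^bsub>G.KG\<^esub> = \<one>\<^bsub>H.KG\<^esub>"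
      using \<theta>\<gamma> hom_one[OF \<theta>\<gamma> G(1) U.group_axioms]
      by (intro G.linear_extension_one H.associative_algebra_KG \<theta>\<gamma>_closed) (simp add: units_of_one)
    then have "?\<phi> (\<one>\<^bsub>G.KG\<^esub> \<oplus>\<^bsub>G.KG\<^esub> G.basis g1 \<oplus>\<^bsub>G.KG\<^esub> G.basis g2) = \<one>\<^bsub>H.KG\<^esub> \<oplus>\<^bsub>H.KG\<^esub> x \<oplus>\<^bsub>H.KG\<^esub> Y"
      using \<phi>_basis[OF g1(1)] \<phi>_basis[OF g2(1)] g1 g2 \<theta>(2,3)
      by (simp add: \<phi>_add G.add_KG_closed G.one_KG)
    also have "\<dots> = (\<one>\<^bsub>H.KG\<^esub> \<oplus>\<^bsub>H.KG\<^esub> x) \<oplus>\<^bsub>H.KG\<^esub> ((\<one>\<^bsub>H.KG\<^esub> \<oplus>\<^bsub>H.KG\<^esub> x) \<oplus>\<^bsub>H.KG\<^esub> y)"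
      by (simp add: Y_def)
    also have "\<dots> = y"
      by (rule KH.char2_add_double[OF char2]) simp_all
    finally show "y = ?\<phi> (\<one>\<^bsub>G.KG\<^esub> \<oplus>\<^bsub>G.KG\<^esub> G.basis g1 \<oplus>\<^bsub>G.KG\<^esub> G.basis g2)" ..
    show "\<one>\<^bsub>G.KG\<^esub> \<oplus>\<^bsub>G.KG\<^esub> G.basis g1 \<oplus>\<^bsub>G.KG\<^esub> G.basis g2 \<in> carrier G.KG"
      by (simp add: G.add_KG_closed G.one_KG)
  qed
  have gen: "carrier H = generate H {a, b}"
    using \<eta>.generate_img[of "{t0.red 1 0 0, t0.red 1 1 1}"] t0.generate_generators H(2)
    by (simp add: a_def b_def iso_def bij_betw_def)
  show ?thesis
  proof (rule algebras_isomorphic_if_generators_in_image[where S = "{a, b}" and \<theta> = "\<theta> \<circ> \<gamma>"])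
    fix s assume "s \<in> {a, b}"
    then consider "s = a" | "s = b" by blast
    then show "H.basis s \<in> ?\<phi> ` carrier G.KG"
      by cases (use x_img y_img in \<open>simp_all only: x_def y_def\<close>)
  qed (fact G.finite_group_algebra_axioms H.finite_group_algebra_axioms K(2) \<theta>\<gamma> gen
      | simp add: order_G order_H)+
qed

theorem theorem5:
  fixes m n k :: nat
  assumes "n > m" and "m \<ge> k" and "k \<ge> 3"
  shows "\<exists>(G :: nat monoid) (H :: nat monoid).
    finite_p_group 2 G \<and> finite_p_group 2 H \<and>
    \<not> G \<cong> H \<and>
    order G = 2 ^ (m + n + k - 1) \<and> order H = 2 ^ (m + n + k - 1) \<and>
    cyclic_group (commutator_subgroup G) \<and> order (commutator_subgroup G) = 2 ^ (k - 1) \<and>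
    cyclic_group (commutator_subgroup H) \<and> order (commutator_subgroup H) = 2 ^ (k - 1) \<and>
    algebras_isomorphic (residue_ring 2)
      (group_algebra (residue_ring 2) G) (group_algebra (residue_ring 2) H)"
proof -
  \<comment> \<open>The modulus \<open>2 ^ k\<close> of the last coordinate is
    \<open>2 ^ Suc l\<close>; the bounds \<open>k \<le> m\<close> and \<open>3 \<le> k\<close>
    become \<open>l < m\<close> and \<open>2 \<le> l\<close>.\<close>
  define l where "l = k - 1"
  have lmn: "l < m" "m < n" "2 \<le> l" and exponent: "m + n + k - 1 = n + m + l"
    using assms by (auto simp: l_def)
  \<comment> \<open>Orders and commutator subgroups are the same for every \<open>e\<close>, so both
    groups are obtained from one argument.\<close>
  have nat_copy: "\<exists>(G :: nat monoid) \<gamma>. \<gamma> \<in> iso (twisted_group n m l e) G \<and>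
      finite_p_group 2 G \<and> order G = 2 ^ (m + n + k - 1) \<and>
      cyclic_group (commutator_subgroup G) \<and> order (commutator_subgroup G) = 2 ^ (k - 1)" for e
  proof -
    interpret twisted n m l e
      using lmn by unfold_locales auto
    obtain G :: "nat monoid" and \<gamma> where G: "group G" "\<gamma> \<in> iso T G"
      using iso_nat_monoid[OF group_T finite_T] by blast
    have order: "order G = 2 ^ (m + n + k - 1)"
      using iso_same_card[OF is_isoI[OF G(2)]] order_T exponent by (simp add: order_def)
    have iso': "commutator_subgroup T \<cong> commutator_subgroup G"
      using iso_commutator_subgroup[OF group_T G] by (auto simp: is_iso_def)
    have "order (commutator_subgroup G) = 2 ^ (k - 1)"
      using iso_same_card[OF iso'] order_commutator_subgroup_T by (simp add: order_def l_def)
    moreover have "group (commutator_subgroup T)" "group (commutator_subgroup G)"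
      using T.derived_is_subgroup[OF subset_refl] group.derived_is_subgroup[OF G(1) subset_refl]
      unfolding commutator_subgroup_def
      by (simp_all add: T.subgroup_imp_group group.subgroup_imp_group[OF G(1)])
    then have "cyclic_group (commutator_subgroup G)"
      using isomorphic_group_cyclicity[OF iso'] cyclic_commutator_subgroup_T by simp
    moreover have "finite_p_group 2 G"
      using G(1) order monoid.order_gt_0_iff_finite[OF group.is_monoid[OF G(1)]] by (auto simp: finite_p_group_def)
    ultimately show ?thesis
      using G(2) order by blast
  qed
  obtain G :: "nat monoid" and \<gamma> where G: "\<gamma> \<in> iso (twisted_group n m l 1) G"
    "finite_p_group 2 G" "order G = 2 ^ (m + n + k - 1)"
    "cyclic_group (commutator_subgroup G)" "order (commutator_subgroup G) = 2 ^ (k - 1)"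
    using nat_copy[of 1] by blast
  obtain H :: "nat monoid" and \<eta> where H: "\<eta> \<in> iso (twisted_group n m l 0) H"
    "finite_p_group 2 H" "order H = 2 ^ (m + n + k - 1)"
    "cyclic_group (commutator_subgroup H)" "order (commutator_subgroup H) = 2 ^ (k - 1)"
    using nat_copy[of 0] by blast
  have groups: "group G" "group H" "group (twisted_group n m l 1)" "group (twisted_group n m l 0)"
    using G(2) H(2) lmn twisted.group_T[of n m l] by (auto simp: finite_p_group_def twisted_def)
  have "\<not> G \<cong> H"
  proof
    assume "G \<cong> H"
    \<comment> \<open>The witness exists for \<open>e = 0\<close>, so the isomorphism has to start
      from that side.\<close>
    then have "H \<cong> G"
      using groups by (simp add: group.iso_sym)
    then obtain \<psi> where "\<psi> \<in> iso (twisted_group n m l 0) (twisted_group n m l 1)"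
      using G(1) H(1) groups by (metis ex_in_conv group.iso_sym is_iso_def iso_trans)
    then show False
      using central_commutator_witness_iso[OF groups(4,3) _ twisted_group_0_central_commutator_witness[OF lmn]]
        twisted_group_1_no_central_commutator_witness[OF lmn] by blast
  qed
  moreover have "algebras_isomorphic (residue_ring 2)
      (group_algebra (residue_ring 2) G) (group_algebra (residue_ring 2) H)"
  proof -
    obtain \<gamma>' where "\<gamma>' \<in> iso G (twisted_group n m l 1)"
      using group.iso_set_sym[OF groups(3) G(1)] by blast
    moreover have "cring (residue_ring 2)"
      by (rule residues.cring) (simp add: residues_def)
    moreover have "finite (carrier (residue_ring 2))"
      "\<one>\<^bsub>residue_ring 2\<^esub> \<oplus>\<^bsub>residue_ring 2\<^esub> \<one>\<^bsub>residue_ring 2\<^esub> = \<zero>\<^bsub>residue_ring 2\<^esub>"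
      by (simp_all add: residue_ring_def)
    ultimately show ?thesis
      using groups H(1) lmn by (intro algebras_isomorphic_twisted_groups)
  qed
  ultimately show ?thesis
    using G(2-) H(2-) by blast
qed

end
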